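(* Let $Q_1,\dots,Q_K$ be fractional hitting-sets for $\mathcal B_1,\dots,\mathcal B_K$ respectively. In each of the following three cases, the algorithm PRA-multi terminates with probability one in a configuration avoiding all bad-events. (a) Suppose that $\mu:\mathcal A\times[K]\to[0,\infty)$ satisfies, for all $Y\in\mathcal A$ and all $k\in[K]$, $$\mu(Y,k)\ \ge\ p^YQ_k(Y)\sum_{\mathcal T\in\mathrm{GNS}(Y,k)}\ \prod_{(Y',k')\in\mathcal T}\mu(Y',k').$$ Then the expected number of resamplings is at most $\sum_{(Y,k)\in\mathcal A\times[K]}\mu(Y,k)$. (b) Suppose that $\mu:\mathcal A\times[K]\to[0,\infty)$ satisfies, for all $Y\in\mathcal A$ and all $k\in[K]$, $$\mu(Y,k)\ \ge\ p^YQ_k(Y)\Bigl(\prod_{Y'\sim Y}\bigl(1+\sum_{k'\in[K]}\mu(Y',k')\bigr)\Bigr)\Bigl(1+\sum_{Y''\bowtie_kY}\mu(Y'',k)\Bigr).$$ Then the expected number of resamplings is at most $\sum_{(Y,k)}\mu(Y,k)$. (c) Suppose that $p^YQ_k(Y)\le P$ for all $Y\in\mathcal A$, $k\in[K]$; that for every supported pair $(Y,k)$ there are at most $D$ supported pairs $(Y',k')$ with $(Y',k')\approx(Y,k)$; and that $ePD\le1$. Then the expected number of resamplings is at most $e\sum_{(Y,k)}p^YQ_k(Y)$.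
   Context: Variables $X_1,\dots,X_n$; variable $X_i$ takes values in a finite set $F_i$. An element is a pair $(i,j)$ with $i\in[n]$, $j\in F_i$; $\mathcal X$ is the set of all elements. $p\in[0,1]^{\mathcal X}$ is a probability vector: $\sum_{j\in F_i}p_{i,j}=1$ for each $i$. $\mathcal A\subseteq2^{\mathcal X}$ is the family of atomic sets: all non-empty sets $\{(i_1,j_1),\dots,(i_r,j_r)\}$ with $i_1,\dots,i_r$ distinct and $j_\ell\in F_{i_\ell}$. $Y\in\mathcal A$ holds (is true) on a configuration $(X_1,\dots,X_n)$ if $X_i=j$ for all $(i,j)\in Y$. $p^Y=\prod_{x\in Y}p_x$. There are $K$ (complex) bad-events $\mathcal B_1,\dots,\mathcal B_K\subseteq\mathcal A$, not necessarily disjoint; a configuration avoids all bad-events if no $B\in\mathcal B_1\cup\dots\cup\mathcal B_K$ holds on it. A function $Q_k:\mathcal A\to[0,1]$ is a fractional hitting-set for $\mathcal B_k$ if $\sum_{Y\subseteq B,\,Y\neq\emptyset}Q_k(Y)\ge1$ for every $B\in\mathcal B_k$. A pair $(Y,k)$ is supported if $Q_k(Y)>0$. PRA-multi: draw $X_1,\dots,X_n$ independently with $\Pr(X_i=j)=p_{i,j}$. While some $B\in\mathcal B_1\cup\dots\cup\mathcal B_K$ is true: arbitrarily select $k\in[K]$ and a true $B\in\mathcal B_k$; select exactly one subset $Y\subseteq B$, a given $Y$ with probability $Q_k(Y)/\sum_{Z\subseteq B}Q_k(Z)$; resample every variable involved in $Y$ independently according to $p$. Return $X$. Each iteration of the loop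 is one resampling. Relations: for $Y,Y'\in\mathcal A$, $Y\sim Y'$ iff there are $i,j,j'$ with $(i,j)\in Y$ and $(i,j')\in Y'$ (so $Y\sim Y$). $Y\bowtie_kY'$ iff $Y\not\sim Y'$ and there is $B\in\mathcal B_k$ with $Y,Y'\subseteq B$. For pairs, $(Y,k)\approx(Y',k')$ iff $Y\sim Y'$, or $k=k'$ and $Y\bowtie_kY'$ (so a pair is $\approx$ itself). For $Y\in\mathcal A$, $k\in[K]$, a set $\mathcal T\subseteq\mathcal A\times[K]$ is a good neighbor-set of $(Y,k)$, written $\mathcal T\in\mathrm{GNS}(Y,k)$, if: (1) every $(Z,\ell)\in\mathcal T$ has either $Z\sim Y$, or $\ell=k$ and $Z\bowtie_kY$; (2) there are no two distinct pairs $(Z,\ell),(Z',\ell')\in\mathcal T$ with $Z\sim Z'$; (3) there are no two distinct pairs $(Z,k),(Z',k)\in\mathcal T$ with $Z\bowtie_kY$ and $Z'\bowtie_kY$. (The empty set is allowed; empty products equal 1.) *)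

theory Defs
  imports "HOL-Probability.Probability" "HOL-Probability.SPMF" "HOL-Probability.Product_PMF"
begin

text \<open>
  The variables are indexed by \<open>{1..n}\<close>, and variable \<open>i\<close> takes values in \<open>F i\<close>. The element \<open>(i, j)\<close>
  stands for the assignment of the value \<open>j\<close> to variable \<open>i\<close>. Configurations are \<open>undefined\<close> outside
  \<open>{1..n}\<close>, as in \<open>PiE\<close>.
\<close>

type_synonym 'v element = "nat \<times> 'v"
type_synonym 'v config = "nat \<Rightarrow> 'v"

definition elements :: "nat \<Rightarrow> (nat \<Rightarrow> 'v set) \<Rightarrow> 'v element set" where
  "elements n F = Sigma {1..n} F"

definition probability_vector :: "nat \<Rightarrow> (nat \<Rightarrow> 'v set) \<Rightarrow> ('v element \<Rightarrow> real) \<Rightarrow> bool" where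
  "probability_vector n F p \<longleftrightarrow>
     (\<forall>x\<in>elements n F. 0 \<le> p x \<and> p x \<le> 1) \<and> (\<forall>i\<in>{1..n}. (\<Sum>j\<in>F i. p (i, j)) = 1)"

definition atomic_sets :: "nat \<Rightarrow> (nat \<Rightarrow> 'v set) \<Rightarrow> 'v element set set" where
  "atomic_sets n F = {Y. Y \<noteq> {} \<and> Y \<subseteq> elements n F \<and> inj_on fst Y}"

definition holds_on :: "'v element set \<Rightarrow> 'v config \<Rightarrow> bool" where
  "holds_on Y X \<longleftrightarrow> (\<forall>(i, j)\<in>Y. X i = j)"

definition avoids_all :: "nat \<Rightarrow> (nat \<Rightarrow> 'v element set set) \<Rightarrow> 'v config \<Rightarrow> bool" where
  "avoids_all K \<B> X \<longleftrightarrow> (\<forall>B \<in> (\<Union>k\<in>{1..K}. \<B> k). \<not> holds_on B X)"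

definition fractional_hitting_set ::
  "nat \<Rightarrow> (nat \<Rightarrow> 'v set) \<Rightarrow> 'v element set set \<Rightarrow> ('v element set \<Rightarrow> real) \<Rightarrow> bool" where
  "fractional_hitting_set n F Bk q \<longleftrightarrow>
     (\<forall>Y\<in>atomic_sets n F. 0 \<le> q Y \<and> q Y \<le> 1) \<and>
     (\<forall>B\<in>Bk. (\<Sum>Y | Y \<subseteq> B \<and> Y \<noteq> {}. q Y) \<ge> 1)"

section \<open>Relations between atomic sets\<close>

definition sim :: "'v element set \<Rightarrow> 'v element set \<Rightarrow> bool" where
  "sim Y Y' \<longleftrightarrow> (\<exists>i j j'. (i, j) \<in> Y \<and> (i, j') \<in> Y')"

definition bowtie :: "'v element set set \<Rightarrow> 'v element set \<Rightarrow> 'v element set \<Rightarrow> bool" where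
  "bowtie Bk Y Y' \<longleftrightarrow> \<not> sim Y Y' \<and> (\<exists>B\<in>Bk. Y \<subseteq> B \<and> Y' \<subseteq> B)"

definition approx_pair ::
  "(nat \<Rightarrow> 'v element set set) \<Rightarrow> 'v element set \<times> nat \<Rightarrow> 'v element set \<times> nat \<Rightarrow> bool" where
  "approx_pair \<B> = (\<lambda>(Y, k) (Y', k'). sim Y Y' \<or> (k = k' \<and> bowtie (\<B> k) Y Y'))"

definition GNS ::
  "nat \<Rightarrow> (nat \<Rightarrow> 'v set) \<Rightarrow> nat \<Rightarrow> (nat \<Rightarrow> 'v element set set) \<Rightarrow>
   'v element set \<Rightarrow> nat \<Rightarrow> ('v element set \<times> nat) set set" where
  "GNS n F K \<B> Y k =
     {T. T \<subseteq> atomic_sets n F \<times> {1..K} \<and>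
         (\<forall>(Z, l)\<in>T. sim Z Y \<or> (l = k \<and> bowtie (\<B> k) Z Y)) \<and>
         (\<forall>(Z, l)\<in>T. \<forall>(Z', l')\<in>T. (Z, l) \<noteq> (Z', l') \<longrightarrow> \<not> sim Z Z') \<and>
         (\<forall>Z Z'. (Z, k) \<in> T \<and> (Z', k) \<in> T \<and> Z \<noteq> Z' \<longrightarrow>
            \<not> (bowtie (\<B> k) Z Y \<and> bowtie (\<B> k) Z' Y))}"

section \<open>The algorithm\<close>

definition var_pmf :: "(nat \<Rightarrow> 'v set) \<Rightarrow> ('v element \<Rightarrow> real) \<Rightarrow> nat \<Rightarrow> 'v pmf" where
  "var_pmf F p i = embed_pmf (\<lambda>j. if j \<in> F i then p (i, j) else 0)"

definition subset_pmf ::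
  "('v element set \<Rightarrow> real) \<Rightarrow> 'v element set \<Rightarrow> 'v element set pmf" where
  "subset_pmf q B =
     embed_pmf (\<lambda>Y. if Y \<subseteq> B \<and> Y \<noteq> {} then q Y / (\<Sum>Z | Z \<subseteq> B \<and> Z \<noteq> {}. q Z) else 0)"

definition resample ::
  "(nat \<Rightarrow> 'v set) \<Rightarrow> ('v element \<Rightarrow> real) \<Rightarrow> 'v element set \<Rightarrow> 'v config \<Rightarrow> 'v config pmf" where
  "resample F p Y X =
     map_pmf (\<lambda>Z. override_on X Z (fst ` Y)) (Pi_pmf (fst ` Y) undefined (var_pmf F p))"

text \<open>
  A history lists the resamplings performed so far, the latest first. The entry \<open>(X, k, B, Y)\<close> gives
  the configuration before the resampling, the selected \<open>k\<close> and \<open>B\<close>, and the resampled \<open>Y \<subseteq> B\<close>.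

  The arbitrary selection of \<open>k\<close> and of a true \<open>B\<close> in \<open>\<B> k\<close> is modelled by a selection rule, which may
  depend on the whole history and on the current configuration, and may itself be randomized.
\<close>

type_synonym 'v history = "('v config \<times> nat \<times> 'v element set \<times> 'v element set) list"
type_synonym 'v selection = "'v history \<Rightarrow> 'v config \<Rightarrow> (nat \<times> 'v element set) pmf"

definition valid_selection ::
  "nat \<Rightarrow> (nat \<Rightarrow> 'v set) \<Rightarrow> nat \<Rightarrow> (nat \<Rightarrow> 'v element set set) \<Rightarrow> 'v selection \<Rightarrow> bool" where
  "valid_selection n F K \<B> sel \<longleftrightarrow>
     (\<forall>h. \<forall>X \<in> PiE {1..n} F. \<not> avoids_all K \<B> X \<longrightarrow>
        set_pmf (sel h X) \<subseteq> {(k, B). k \<in> {1..K} \<and> B \<in> \<B> k \<and> holds_on B X})"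

partial_function (spmf) pra_loop ::
  "(nat \<Rightarrow> 'v set) \<Rightarrow> ('v element \<Rightarrow> real) \<Rightarrow> nat \<Rightarrow> (nat \<Rightarrow> 'v element set set) \<Rightarrow>
   (nat \<Rightarrow> 'v element set \<Rightarrow> real) \<Rightarrow> 'v selection \<Rightarrow>
   'v history \<Rightarrow> 'v config \<Rightarrow> ('v history \<times> 'v config) spmf" where
  "pra_loop F p K \<B> Q sel h X =
     (if avoids_all K \<B> X then return_spmf (h, X)
      else do {
        (k, B) \<leftarrow> spmf_of_pmf (sel h X);
        Y \<leftarrow> spmf_of_pmf (subset_pmf (Q k) B);
        X' \<leftarrow> spmf_of_pmf (resample F p Y X);
        pra_loop F p K \<B> Q sel ((X, k, B, Y) # h) X'
      })"

definition pra_multi ::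
  "nat \<Rightarrow> (nat \<Rightarrow> 'v set) \<Rightarrow> ('v element \<Rightarrow> real) \<Rightarrow> nat \<Rightarrow> (nat \<Rightarrow> 'v element set set) \<Rightarrow>
   (nat \<Rightarrow> 'v element set \<Rightarrow> real) \<Rightarrow> 'v selection \<Rightarrow> ('v history \<times> 'v config) spmf" where
  "pra_multi n F p K \<B> Q sel =
     do {
       X \<leftarrow> spmf_of_pmf (Pi_pmf {1..n} undefined (var_pmf F p));
       pra_loop F p K \<B> Q sel [] X
     }"

definition terminates_avoiding ::
  "nat \<Rightarrow> (nat \<Rightarrow> 'v element set set) \<Rightarrow> ('v history \<times> 'v config) spmf \<Rightarrow> bool" where
  "terminates_avoiding K \<B> run \<longleftrightarrow>
     lossless_spmf run \<and> (\<forall>(h, X) \<in> set_spmf run. avoids_all K \<B> X)"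

text \<open>
  The outcome \<open>None\<close> of an \<open>spmf\<close> is the event that the loop runs forever, which costs infinitely many
  resamplings.
\<close>

definition expected_resamplings :: "('v history \<times> 'v config) spmf \<Rightarrow> ennreal" where
  "expected_resamplings run =
     (\<integral>\<^sup>+ r. (case r of None \<Rightarrow> \<infinity> | Some (h, X) \<Rightarrow> of_nat (length h)) \<partial>measure_pmf run)"

end

theory Submission imports Defs begin

text \<open>
  The proof is a witness tree argument in the style of Moser and Tardos, with a potential function in
  place of their resampling table. A run is a sequence of resampled pairs \<open>(Y, k)\<close>. Read the first \<open>t\<close> of them backwards,
  and build a tree: the last pair is the root, and each earlier pair that can have influenced a
  pair already in the tree is hung below the deepest such pair. Every resampling yields one
  tree, so the expected number of resamplings is the sum, over all trees \<open>\<tau>\<close>, of the expected number of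
  times at which \<open>\<tau>\<close> is the tree built. This is shown to be at most the product of \<open>p\<^sup>Y Q\<^sub>k(Y)\<close> over
  the nodes of \<open>\<tau>\<close>. In such a tree the children of a node labelled \<open>(Y, k)\<close> form a good neighbour set of \<open>(Y, k)\<close>,
  and so the total weight of the trees with root \<open>(Y, k)\<close> is at most \<open>\<mu> (Y, k)\<close>, by induction on the depth.

  \<^bold>\<open>Influence.\<close> Sharing a variable (\<open>sim\<close>) always counts. Sharing a bad event (\<open>bowtie\<close>) counts only
  towards a node that has no child yet. This asymmetry gives the third condition on good neighbour
  sets, that at most one child is a \<open>bowtie\<close> child. It is also enough for the
  probabilistic estimate: only a leaf can be the earliest resampling that a tree records, and
  two leaves that both could be earliest are never contained in a common bad event of the same
  family (\<open>attach_inj\<close>).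

  \<^bold>\<open>Probability of a tree.\<close> For a tree \<open>\<tau>\<close> and a configuration \<open>X\<close>, the potential of \<open>\<tau>\<close> at \<open>X\<close> is the
  weight of \<open>\<tau>\<close> conditioned on the present values: each variable that occurs in \<open>\<tau>\<close> must now have the
  value demanded by its deepest occurrence, and its other occurrences cost their probability \<open>p\<close>. Suppose that
  the bad event \<open>B\<close> is selected. If a leaf \<open>Y \<subseteq> B\<close> of \<open>\<tau>\<close> can be the earliest, then every
  \<open>Z \<subseteq> B\<close> other than \<open>Y\<close> influences that leaf and would have to be recorded, so \<open>\<tau>\<close> is lost unless \<open>Y\<close> itself is
  drawn. This has probability at most \<open>Q\<^sub>k(Y)\<close>, because the total mass of \<open>Q\<^sub>k\<close> on subsets of \<open>B\<close> is at
  least one, and the factor cancels against the one that the leaf contributes. If there is no such leaf, then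
  \<open>\<tau>\<close> survives only if the resampled variables do not occur in it. In both cases the potential does not
  increase in expectation (\<open>potential_step\<close>).

  \<^bold>\<open>The loop.\<close> Summing over all trees that \<open>N\<close> resamplings can produce bounds the expectation of the number of
  resamplings truncated at \<open>N\<close> (\<open>truncated_cost_pra_loop\<close>), whatever the selection rule
  does. Divergence and a bad final configuration are both given infinite cost, so
  monotone convergence in \<open>N\<close> yields termination, correctness and the expectation bound at once.

  The cluster-expansion criterion and the symmetric criterion follow from the good neighbour criterion by
  bounding its sum: by a product that allows one entry per row, and by \<open>(1 + e P)\<^sup>D \<le> e\<close> respectively.
\<close>

section \<open>Witness trees\<close>

text \<open>
  A tree is a set of nodes. A node is the list of labels on the path from it up to the root,
  its own label first, so \<open>c # v\<close> is the child of \<open>v\<close> labelled \<open>c\<close> and the length of the list is the depth of the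
  node. This presupposes that siblings carry different labels, which holds here because \<open>strong\<close>
  is reflexive and siblings are never \<open>strong\<close>ly related. The relation \<open>strong\<close> stands for \<open>sim\<close> on pairs, and \<open>weak\<close> for \<open>bowtie\<close>.
\<close>

locale witness_trees =
  fixes L :: "'l set"
    and strong weak :: "'l \<Rightarrow> 'l \<Rightarrow> bool"
  assumes finite_labels: "finite L"
    and strong_refl: "e \<in> L \<Longrightarrow> strong e e"
    and strong_sym: "strong e f \<Longrightarrow> strong f e"
    and weak_sym: "weak e f \<Longrightarrow> weak f e"
    and weak_not_strong: "weak e f \<Longrightarrow> \<not> strong e f"
begin

text \<open>
  A weak relation makes a node eligible only as long as it is a leaf. A node therefore has at most one
  weak child, and that child is the first one attached.
\<close>
definition eligible :: "'l list set \<Rightarrow> 'l \<Rightarrow> 'l list \<Rightarrow> bool" where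
  "eligible \<tau> e v \<longleftrightarrow>
     v \<in> \<tau> \<and> (strong e (hd v) \<or> weak e (hd v) \<and> (\<forall>c. c # v \<notin> \<tau>))"

definition host :: "'l list set \<Rightarrow> 'l \<Rightarrow> 'l list" where
  "host \<tau> e = (SOME v. eligible \<tau> e v \<and> (\<forall>u. eligible \<tau> e u \<longrightarrow> length u \<le> length v))"

definition attach :: "'l \<Rightarrow> 'l list set \<Rightarrow> 'l list set" where
  "attach e \<tau> =
     (if \<tau> = {} then {[e]}
      else if \<exists>v. eligible \<tau> e v then insert (e # host \<tau> e) \<tau> else \<tau>)"

text \<open>
  The last three clauses become the three conditions on good neighbour sets. The second of them ranges
  over a whole level of the tree rather than over siblings, since two nodes of equal depth that share a
  variable could not be ordered in time.
\<close>
definition wf_tree :: "'l list set \<Rightarrow> bool" where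
  "wf_tree \<tau> \<longleftrightarrow>
     finite \<tau> \<and>
     (\<forall>v\<in>\<tau>. v \<noteq> [] \<and> set v \<subseteq> L) \<and>
     (\<forall>u\<in>\<tau>. \<forall>v\<in>\<tau>. last u = last v) \<and>
     (\<forall>c v. c # v \<in> \<tau> \<and> v \<noteq> [] \<longrightarrow> v \<in> \<tau> \<and> (strong c (hd v) \<or> weak c (hd v))) \<and>
     (\<forall>u\<in>\<tau>. \<forall>v\<in>\<tau>. u \<noteq> v \<and> length u = length v \<longrightarrow> \<not> strong (hd u) (hd v)) \<and>
     (\<forall>c c' v. c # v \<in> \<tau> \<and> c' # v \<in> \<tau> \<and> v \<noteq> [] \<and> weak c (hd v) \<and> weak c' (hd v) \<longrightarrow> c = c')"

lemma wf_treeD: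
  assumes "wf_tree \<tau>"
  shows wf_finite: "finite \<tau>"
    and wf_node: "v \<in> \<tau> \<Longrightarrow> v \<noteq> []" "v \<in> \<tau> \<Longrightarrow> set v \<subseteq> L"
    and wf_root: "u \<in> \<tau> \<Longrightarrow> v \<in> \<tau> \<Longrightarrow> last u = last v"
    and wf_parent: "c # v \<in> \<tau> \<Longrightarrow> v \<noteq> [] \<Longrightarrow> v \<in> \<tau>"
    and wf_child: "c # v \<in> \<tau> \<Longrightarrow> v \<noteq> [] \<Longrightarrow> strong c (hd v) \<or> weak c (hd v)"
    and wf_level: "u \<in> \<tau> \<Longrightarrow> v \<in> \<tau> \<Longrightarrow> u \<noteq> v \<Longrightarrow> length u = length v \<Longrightarrow> \<not> strong (hd u) (hd v)"
    and wf_weak_child: "c # v \<in> \<tau> \<Longrightarrow> c' # v \<in> \<tau> \<Longrightarrow> v \<noteq> [] \<Longrightarrow> weak c (hd v) \<Longrightarrow> weak c' (hd v) \<Longrightarrow> c = c'"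
proof -
  note parts = assms[unfolded wf_tree_def]
  show "finite \<tau>" using parts by (elim conjE)
  have node: "\<forall>v\<in>\<tau>. v \<noteq> [] \<and> set v \<subseteq> L" using parts by (elim conjE)
  show "v \<in> \<tau> \<Longrightarrow> v \<noteq> []" "v \<in> \<tau> \<Longrightarrow> set v \<subseteq> L" using node by blast+
  have "\<forall>u\<in>\<tau>. \<forall>v\<in>\<tau>. last u = last v" using parts by (elim conjE)
  then show "u \<in> \<tau> \<Longrightarrow> v \<in> \<tau> \<Longrightarrow> last u = last v" by (elim ballE) auto
  have par: "\<forall>c v. c # v \<in> \<tau> \<and> v \<noteq> [] \<longrightarrow> v \<in> \<tau> \<and> (strong c (hd v) \<or> weak c (hd v))"
    using parts by (elim conjE)
  show "c # v \<in> \<tau> \<Longrightarrow> v \<noteq> [] \<Longrightarrow> v \<in> \<tau>"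
    "c # v \<in> \<tau> \<Longrightarrow> v \<noteq> [] \<Longrightarrow> strong c (hd v) \<or> weak c (hd v)"
    using par[rule_format, of c v] by blast+
  have "\<forall>u\<in>\<tau>. \<forall>v\<in>\<tau>. u \<noteq> v \<and> length u = length v \<longrightarrow> \<not> strong (hd u) (hd v)"
    using parts by (elim conjE)
  from this[rule_format, of u v]
  show "u \<in> \<tau> \<Longrightarrow> v \<in> \<tau> \<Longrightarrow> u \<noteq> v \<Longrightarrow> length u = length v \<Longrightarrow> \<not> strong (hd u) (hd v)"
    by blast
  have "\<forall>c c' v. c # v \<in> \<tau> \<and> c' # v \<in> \<tau> \<and> v \<noteq> [] \<and> weak c (hd v) \<and> weak c' (hd v) \<longrightarrow> c = c'"
    using parts by (elim conjE)
  from this[rule_format, of c v c']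
  show "c # v \<in> \<tau> \<Longrightarrow> c' # v \<in> \<tau> \<Longrightarrow> v \<noteq> [] \<Longrightarrow> weak c (hd v) \<Longrightarrow> weak c' (hd v) \<Longrightarrow> c = c'"
    by blast
qed

lemma wf_hd: "wf_tree \<tau> \<Longrightarrow> v \<in> \<tau> \<Longrightarrow> hd v \<in> L"
  using wf_node[of \<tau> v] by (metis list.set_sel(1) subsetD)

lemma wf_root_in: "wf_tree \<tau> \<Longrightarrow> v \<in> \<tau> \<Longrightarrow> [last v] \<in> \<tau>"
proof (induction v)
  case Nil
  then show ?case using wf_node(1) by blast
next
  case (Cons c v)
  then show ?case using wf_parent[OF Cons.prems(1), of c v] by (cases "v = []") auto
qed

lemma host_deepest:
  assumes "wf_tree \<tau>" "eligible \<tau> e v"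
  shows "eligible \<tau> e (host \<tau> e)" "eligible \<tau> e u \<Longrightarrow> length u \<le> length (host \<tau> e)"
proof -
  have fin: "finite {v. eligible \<tau> e v}"
    by (rule finite_subset[OF _ wf_finite[OF assms(1)]]) (auto simp: eligible_def)
  have "\<exists>v. eligible \<tau> e v \<and> (\<forall>u. eligible \<tau> e u \<longrightarrow> length u \<le> length v)"
  proof -
    have "Max (length ` {v. eligible \<tau> e v}) \<in> length ` {v. eligible \<tau> e v}"
      using fin assms(2) by (intro Max_in) auto
    then obtain v where "eligible \<tau> e v" "length v = Max (length ` {v. eligible \<tau> e v})"
      by auto
    moreover have "length u \<le> Max (length ` {v. eligible \<tau> e v})" if "eligible \<tau> e u" for u
      using fin that by (intro Max_ge) auto
    ultimately show ?thesis by metis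
  qed
  from someI_ex[OF this]
  show "eligible \<tau> e (host \<tau> e)" "eligible \<tau> e u \<Longrightarrow> length u \<le> length (host \<tau> e)"
    unfolding host_def by blast+
qed

lemma attach_empty [simp]: "attach e {} = {[e]}"
  by (simp add: attach_def)

text \<open>
  The new node lies strictly deeper than every eligible node, because its parent is the deepest of them. In particular
  it is not in the tree yet: a node labelled \<open>e\<close> is eligible for \<open>e\<close>.
\<close>
lemma attach_cases:
  assumes wf: "wf_tree \<sigma>" and e: "e \<in> L"
  obtains (unrelated) "attach e \<sigma> = \<sigma>" "\<sigma> \<noteq> {}" "\<And>v. \<not> eligible \<sigma> e v"
  | (new) h where "attach e \<sigma> = insert (e # h) \<sigma>" "e # h \<notin> \<sigma>"
      "\<And>v. eligible \<sigma> e v \<Longrightarrow> length v < length (e # h)"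
      "\<sigma> = {} \<Longrightarrow> h = []" "\<sigma> \<noteq> {} \<Longrightarrow> eligible \<sigma> e h"
proof (cases "\<exists>v. eligible \<sigma> e v")
  case True
  then obtain v where v: "eligible \<sigma> e v" by blast
  note h = host_deepest[OF wf v]
  have "\<not> eligible \<sigma> e (e # host \<sigma> e)"
    using h(2)[of "e # host \<sigma> e"] by auto
  then have "e # host \<sigma> e \<notin> \<sigma>"
    using strong_refl[OF e] by (auto simp: eligible_def)
  moreover have "\<sigma> \<noteq> {}" using v by (auto simp: eligible_def)
  ultimately show ?thesis
    using True h by (intro new[of "host \<sigma> e"]) (auto simp: attach_def le_imp_less_Suc)
next
  case False
  then show ?thesis
  proof (cases "\<sigma> = {}")
    case True
    then show ?thesis by (intro new[of "[]"]) (auto simp: eligible_def)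
  next
    case ne: False
    then show ?thesis using False by (intro unrelated) (auto simp: attach_def)
  qed
qed

lemma attach_neq_empty [simp]: "attach e \<tau> \<noteq> {}"
  by (auto simp: attach_def)

lemma wf_empty: "wf_tree {}"
  by (simp add: wf_tree_def)

text \<open>
  A node at the depth of the new one that is strongly related to it would have been a deeper host, and
  a weak child is hung only below a leaf.
\<close>
lemma wf_attach:
  assumes wf: "wf_tree \<sigma>" and e: "e \<in> L"
  shows "wf_tree (attach e \<sigma>)"
  using wf e
proof (cases rule: attach_cases)
  case unrelated
  then show ?thesis using wf by simp
next
  case (new h)
  show ?thesis
  proof (cases "\<sigma> = {}")
    case True
    then show ?thesis using new(4) e by (auto simp: wf_tree_def)
  next
    case ne: False
    have hel: "eligible \<sigma> e h" using new(5) ne .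
    then have h: "h \<in> \<sigma>" "strong e (hd h) \<or> weak e (hd h) \<and> (\<forall>c. c # h \<notin> \<sigma>)"
      by (auto simp: eligible_def)
    have hn: "h \<noteq> []" "set h \<subseteq> L" using wf_node[OF wf h(1)] .
    have nos: "\<not> strong e (hd v)" if "v \<in> \<sigma>" "length v = length (e # h)" for v
      using new(3)[of v] that by (auto simp: eligible_def)
    show ?thesis unfolding new(1) wf_tree_def
    proof (intro conjI)
      show "finite (insert (e # h) \<sigma>)" using wf_finite[OF wf] by simp
      show "\<forall>v\<in>insert (e # h) \<sigma>. v \<noteq> [] \<and> set v \<subseteq> L"
        using wf_node[OF wf] e hn by auto
      have "last v = last h" if "v \<in> \<sigma>" for v using wf_root[OF wf that h(1)] .
      then show "\<forall>u\<in>insert (e # h) \<sigma>. \<forall>v\<in>insert (e # h) \<sigma>. last u = last v"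
        using hn by auto
      show "\<forall>c v. c # v \<in> insert (e # h) \<sigma> \<and> v \<noteq> [] \<longrightarrow>
              v \<in> insert (e # h) \<sigma> \<and> (strong c (hd v) \<or> weak c (hd v))"
        using wf_parent[OF wf] wf_child[OF wf] h by auto
      show "\<forall>u\<in>insert (e # h) \<sigma>. \<forall>v\<in>insert (e # h) \<sigma>.
              u \<noteq> v \<and> length u = length v \<longrightarrow> \<not> strong (hd u) (hd v)"
        using wf_level[OF wf] nos strong_sym[of _ e] by auto
      show "\<forall>c c' v. c # v \<in> insert (e # h) \<sigma> \<and> c' # v \<in> insert (e # h) \<sigma> \<and> v \<noteq> [] \<and>
              weak c (hd v) \<and> weak c' (hd v) \<longrightarrow> c = c'"
        using wf_weak_child[OF wf] h(2) weak_not_strong by auto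
    qed
  qed
qed

text \<open>
  A tree determines its earliest entry among related labels. If \<open>e\<close> and \<open>e'\<close> are related and both could have
  been attached last, at the leaves \<open>u\<close> and \<open>u'\<close>, then each leaf is an eligible host for the label of the other in
  the tree without that other leaf. So each of them is strictly deeper than the other, unless they
  coincide. If \<open>\<sigma>' = \<tau>\<close>, then \<open>e'\<close> was not recorded although the leaf labelled \<open>e\<close> is eligible for it, which is impossible as well.
\<close>
lemma attach_inj:
  assumes wf: "wf_tree \<sigma>" "wf_tree \<sigma>'" and e: "e \<in> L" "e' \<in> L"
    and \<tau>: "attach e \<sigma> = \<tau>" "attach e' \<sigma>' = \<tau>" and proper: "\<sigma> \<noteq> \<tau>"
    and related: "strong e e' \<or> weak e e'"
  shows "e' = e \<and> \<sigma>' = \<sigma>"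
proof -
  obtain h where h: "\<tau> = insert (e # h) \<sigma>" "e # h \<notin> \<sigma>"
    "\<And>v. eligible \<sigma> e v \<Longrightarrow> length v < length (e # h)"
    by (rule attach_cases[OF wf(1) e(1)]) (use \<tau> proper in auto)
  have leaf: "c # e # h \<notin> \<tau>" for c
    using wf_parent[OF wf(1), of c "e # h"] h(1,2) by auto
  have related': "strong e' e \<or> weak e' e" using related strong_sym weak_sym by blast
  have "eligible \<tau> e' (e # h)"
    using leaf related' h(1) by (auto simp: eligible_def)
  then obtain h' where h': "\<tau> = insert (e' # h') \<sigma>'" "e' # h' \<notin> \<sigma>'"
    "\<And>v. eligible \<sigma>' e' v \<Longrightarrow> length v < length (e' # h')"
    by (rule_tac attach_cases[OF wf(2) e(2)]) (use \<tau> in auto)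
  have leaf': "c # e' # h' \<notin> \<tau>" for c
    using wf_parent[OF wf(2), of c "e' # h'"] h'(1,2) by auto
  show ?thesis
  proof (cases "e # h = e' # h'")
    case True
    have "\<sigma> = \<tau> - {e # h}" using h(1,2) by simp
    moreover have "\<sigma>' = \<tau> - {e' # h'}" using h'(1,2) by simp
    ultimately show ?thesis using True by simp
  next
    case False
    have "e' # h' \<in> \<tau>" "e # h \<in> \<tau>" using h'(1) h(1) by (metis insertI1)+
    then have mem: "e' # h' \<in> \<sigma>" "e # h \<in> \<sigma>'" using h(1) h'(1) False by (metis insertE)+
    have "c # e' # h' \<notin> \<sigma>" "c # e # h \<notin> \<sigma>'" for c
      using leaf[of c] leaf'[of c] h(1) h'(1) by (metis insertI2)+
    then have "eligible \<sigma> e (e' # h')" "eligible \<sigma>' e' (e # h)"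
      using mem related related' by (simp_all add: eligible_def)
    then show ?thesis using h(3)[of "e' # h'"] h'(3)[of "e # h"] by linarith
  qed
qed

text \<open>
  The trees that a sequence of at most \<open>N\<close> resamplings can produce. The empty tree belongs to them and
  stands for the empty sequence.
\<close>
primrec grown :: "nat \<Rightarrow> 'l list set set" where
  "grown 0 = {{}}"
| "grown (Suc N) = insert {} ((\<lambda>(e, \<sigma>). attach e \<sigma>) ` (L \<times> grown N))"

lemma finite_grown: "finite (grown N)"
  by (induction N) (auto simp: finite_labels)

lemma wf_grown: "\<tau> \<in> grown N \<Longrightarrow> wf_tree \<tau>"
  by (induction N arbitrary: \<tau>) (auto simp: wf_empty intro!: wf_attach)

lemma empty_in_grown: "{} \<in> grown N"
  by (cases N) auto

lemma attach_in_grown: "e \<in> L \<Longrightarrow> \<sigma> \<in> grown N \<Longrightarrow> attach e \<sigma> \<in> grown (Suc N)"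
  by auto

lemma length_grown: "\<tau> \<in> grown N \<Longrightarrow> v \<in> \<tau> \<Longrightarrow> length v \<le> N"
proof (induction N arbitrary: \<tau> v)
  case (Suc N)
  from Suc.prems consider "\<tau> = {}" | e \<sigma> where "e \<in> L" "\<sigma> \<in> grown N" "\<tau> = attach e \<sigma>"
    by auto
  then show ?case
  proof cases
    case 1
    then show ?thesis using Suc.prems by simp
  next
    case (2 e \<sigma>)
    note IH = Suc.IH[OF 2(2)]
    from wf_grown[OF 2(2)] 2(1) show ?thesis
    proof (cases rule: attach_cases)
      case unrelated
      then show ?thesis using 2(3) Suc.prems(2) IH[of v] by simp
    next
      case (new h)
      have "length h \<le> N"
        using new(4,5) IH[of h] by (cases "\<sigma> = {}") (auto simp: eligible_def)
      then show ?thesis using new(1) 2(3) Suc.prems(2) IH[of v] by auto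
    qed
  qed
qed simp

end

section \<open>The total weight of trees with prescribed sets of children\<close>

text \<open>The set of labels of the children of a node labelled \<open>e\<close> must belong to \<open>N e\<close>; \<open>d\<close> bounds the depth and \<open>r\<close> is the root.\<close>
definition branching_trees :: "('l \<Rightarrow> 'l set set) \<Rightarrow> nat \<Rightarrow> 'l \<Rightarrow> 'l list set set" where
  "branching_trees N d r =
     {\<tau>. [r] \<in> \<tau> \<and> (\<forall>v\<in>\<tau>. v \<noteq> [] \<and> last v = r \<and> length v \<le> d) \<and>
         (\<forall>c v. c # v \<in> \<tau> \<and> v \<noteq> [] \<longrightarrow> v \<in> \<tau>) \<and> (\<forall>v\<in>\<tau>. {c. c # v \<in> \<tau>} \<in> N (hd v))}"

lemma branching_trees_labels:
  assumes N: "\<And>e. e \<in> L \<Longrightarrow> N e \<subseteq> Pow L" and r: "r \<in> L"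
    and \<tau>: "\<tau> \<in> branching_trees N d r" and v: "v \<in> \<tau>"
  shows "set v \<subseteq> L"
  using v
proof (induction v)
  case (Cons c v)
  show ?case
  proof (cases "v = []")
    case True
    then show ?thesis using Cons.prems \<tau> r by (auto simp: branching_trees_def)
  next
    case False
    then have "v \<in> \<tau>" using Cons.prems \<tau> unfolding branching_trees_def by blast
    then have v: "set v \<subseteq> L" and C: "{c. c # v \<in> \<tau>} \<in> N (hd v)"
      using Cons.IH \<tau> unfolding branching_trees_def by blast+
    from v False have "hd v \<in> L" by (cases v) auto
    from N[OF this] C have "c \<in> L" using Cons.prems by blast
    then show ?thesis using v by simp
  qed
qed simp

lemma finite_branching_trees:
  assumes L: "finite L" and N: "\<And>e. e \<in> L \<Longrightarrow> N e \<subseteq> Pow L" and r: "r \<in> L"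
  shows "finite (branching_trees N d r)"
proof -
  have "finite (Pow {v. set v \<subseteq> L \<and> length v \<le> d})"
    using finite_lists_length_le[OF L, of d] by simp
  moreover have "branching_trees N d r \<subseteq> Pow {v. set v \<subseteq> L \<and> length v \<le> d}"
  proof (rule subsetI, rule PowI, rule subsetI, intro CollectI conjI)
    fix \<tau> v assume \<tau>: "\<tau> \<in> branching_trees N d r" and v: "v \<in> \<tau>"
    show "set v \<subseteq> L" by (rule branching_trees_labels[OF N r \<tau> v])
    show "length v \<le> d" using \<tau> v by (simp add: branching_trees_def)
  qed
  ultimately show ?thesis by (rule rev_finite_subset)
qed

text \<open>
  Removing the root splits a tree into the set \<open>C\<close> of labels of the children and one tree of smaller depth
  for each of them, and the weight is multiplicative over this decomposition. So the sum over trees is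
  at most a sum over \<open>C\<close> of products of smaller sums, and the hypothesis on \<open>\<mu>\<close> closes the induction on the depth.
\<close>
lemma sum_branching_trees_le:
  fixes w \<mu> :: "'l \<Rightarrow> real"
  assumes L: "finite L" and N: "\<And>e. e \<in> L \<Longrightarrow> N e \<subseteq> Pow L"
    and w: "\<And>e. e \<in> L \<Longrightarrow> 0 \<le> w e" and \<mu>: "\<And>e. e \<in> L \<Longrightarrow> 0 \<le> \<mu> e"
    and step: "\<And>e. e \<in> L \<Longrightarrow> w e * (\<Sum>T\<in>N e. \<Prod>c\<in>T. \<mu> c) \<le> \<mu> e"
    and r: "r \<in> L"
  shows "(\<Sum>\<tau>\<in>branching_trees N d r. \<Prod>v\<in>\<tau>. w (hd v)) \<le> \<mu> r"
  using r
proof (induction d arbitrary: r)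
  case 0
  have "branching_trees N 0 r = {}" unfolding branching_trees_def by fastforce
  then show ?case using \<mu>[OF 0] by simp
next
  case (Suc d)
  note r = Suc.prems
  let ?W = "\<lambda>\<tau>. \<Prod>v\<in>\<tau>. w (hd v)"
  let ?Tr = "branching_trees N"
  \<comment> \<open>A subtree keeps its own root as last entry; appending \<open>r\<close> moves it below the new root.\<close>
  define graft where "graft = (\<lambda>(C :: 'l set, f). insert [r] (\<Union>c\<in>C. (\<lambda>v. v @ [r]) ` (f c :: 'l list set)))"
  have fin: "finite (?Tr d' e)" if "e \<in> L" for d' e
    by (rule finite_branching_trees[OF L N that])
  have W0: "0 \<le> ?W \<tau>" if "\<tau> \<in> ?Tr d' e" "e \<in> L" for \<tau> d' e
  proof (rule prod_nonneg)
    fix v assume "v \<in> \<tau>"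
    have "set v \<subseteq> L"
      by (rule branching_trees_labels[OF N that(2,1) \<open>v \<in> \<tau>\<close>])
    moreover have "v \<noteq> []" using \<open>v \<in> \<tau>\<close> that(1) by (simp add: branching_trees_def)
    ultimately have "hd v \<in> L" by (cases v) auto
    then show "0 \<le> w (hd v)" by (rule w)
  qed
  have NL: "C \<subseteq> L" "finite C" if "C \<in> N r" for C
    using that N[OF r] finite_subset[OF _ L] by blast+
  have finT: "finite (?Tr d c)" if "C \<in> N r" "c \<in> C" for C c
    using fin NL(1)[OF that(1)] that(2) by blast
  have finN: "finite (N r)" using N[OF r] L by (meson finite_Pow_iff finite_subset)
  have "sum ?W (?Tr (Suc d) r) \<le>
    (\<Sum>(C, f)\<in>(SIGMA C:N r. PiE C (?Tr d)). w r * (\<Prod>c\<in>C. ?W (f c)))"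
  proof (rule sum_le_included[where i = graft], goal_cases)
    case 1
    show ?case using fin[OF r] .
  next
    case 2
    show ?case using finN NL finT by (intro finite_SigmaI finite_PiE) auto
  next
    case 3
    show ?case
    proof (clarify intro!: mult_nonneg_nonneg w[OF r])
      fix C f assume C: "C \<in> N r" and f: "f \<in> PiE C (?Tr d)"
      have "0 \<le> ?W (f c)" if "c \<in> C" for c
        using W0 PiE_mem[OF f that] NL(1)[OF C] that by blast
      then show "0 \<le> w r * (\<Prod>c\<in>C. ?W (f c))"
        by (rule mult_nonneg_nonneg[OF w[OF r] prod_nonneg])
    qed
  next
    case 4
    show ?case
    proof
      fix \<tau> assume \<tau>: "\<tau> \<in> ?Tr (Suc d) r"
      then have root: "[r] \<in> \<tau>"
        and node: "\<And>v. v \<in> \<tau> \<Longrightarrow> v \<noteq> [] \<and> last v = r \<and> length v \<le> Suc d"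
        and parent: "\<And>c v. c # v \<in> \<tau> \<Longrightarrow> v \<noteq> [] \<Longrightarrow> v \<in> \<tau>"
        and children: "\<And>v. v \<in> \<tau> \<Longrightarrow> {c. c # v \<in> \<tau>} \<in> N (hd v)"
        unfolding branching_trees_def by blast+
      define C where "C = {c. [c, r] \<in> \<tau>}"
      define f where "f = (\<lambda>c\<in>C. {v. v \<noteq> [] \<and> last v = c \<and> v @ [r] \<in> \<tau>})"
      have C: "C \<in> N r" using children[OF root] by (simp add: C_def)
      have suffix: "[last v, r] \<in> \<tau>" if "v \<noteq> []" "v @ [r] \<in> \<tau>" for v
        using that
      proof (induction v)
        case (Cons c v)
        then show ?case using parent[of c "v @ [r]"] by (cases "v = []") auto
      qed simp
      have f: "f \<in> PiE C (?Tr d)"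
      proof (rule PiE_I)
        fix c assume c: "c \<in> C"
        then show "f c \<in> ?Tr d c"
          unfolding branching_trees_def f_def
        proof (clarsimp, intro conjI ballI allI impI, goal_cases)
          case 1
          then show ?case by (simp add: C_def)
        next
          case (2 v)
          then show ?case using node[of "v @ [r]"] by simp
        next
          case (3 b v)
          then show ?case using parent[of b "v @ [r]"] by auto
        next
          case (4 v)
          then have "{b. b # v @ [r] \<in> \<tau>} \<in> N (hd (v @ [r]))"
            using children[of "v @ [r]"] by simp
          then show ?case using 4 by simp
        qed
      qed (simp add: f_def)
      have \<tau>_eq: "\<tau> = graft (C, f)"
      proof (intro equalityI subsetI)
        fix v assume v: "v \<in> \<tau>"
        show "v \<in> graft (C, f)"
        proof (cases "v = [r]")
          case True
          then show ?thesis by (simp add: graft_def)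
        next
          case False
          obtain v' where v': "v = v' @ [r]"
            using node[OF v] by (metis append_butlast_last_id)
          then have "v' \<noteq> []" using False by auto
          with suffix[of v'] v v' have "last v' \<in> C" "v' \<in> f (last v')"
            by (auto simp: C_def f_def)
          then show ?thesis using v' by (auto simp: graft_def)
        qed
      qed (use root in \<open>auto simp: graft_def f_def\<close>)
      have finf: "finite (f c)" if c: "c \<in> C" for c
      proof (rule finite_subset)
        have fc: "f c \<in> ?Tr d c" and cL: "c \<in> L"
          using PiE_mem[OF f c] NL(1)[OF C] c by blast+
        have "set v \<subseteq> L" if "v \<in> f c" for v
          by (rule branching_trees_labels[OF N cL fc that])
        then show "f c \<subseteq> {v. set v \<subseteq> L \<and> length v \<le> d}"
          using fc by (auto simp: branching_trees_def)
        show "finite {v. set v \<subseteq> L \<and> length v \<le> d}"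
          using finite_lists_length_le[OF L, of d] by simp
      qed
      have inj: "inj_on (\<lambda>v. v @ [r]) A" for A by (auto simp: inj_on_def)
      have "?W \<tau> = w r * ?W (\<Union>c\<in>C. (\<lambda>v. v @ [r]) ` f c)"
        unfolding \<tau>_eq graft_def prod.case
        by (subst prod.insert) (use finf NL[OF C] in \<open>auto simp: f_def\<close>)
      also have "?W (\<Union>c\<in>C. (\<lambda>v. v @ [r]) ` f c) = (\<Prod>c\<in>C. ?W ((\<lambda>v. v @ [r]) ` f c))"
        by (rule prod.UNION_disjoint) (use finf NL[OF C] in \<open>auto simp: f_def\<close>)
      also have "\<dots> = (\<Prod>c\<in>C. ?W (f c))"
        by (rule prod.cong[OF refl], subst prod.reindex[OF inj], rule prod.cong)
           (auto simp: f_def)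
      finally have "?W \<tau> = w r * (\<Prod>c\<in>C. ?W (f c))" .
      then show "\<exists>y\<in>(SIGMA C:N r. PiE C (?Tr d)). graft y = \<tau> \<and>
          ?W \<tau> \<le> (case y of (C, f) \<Rightarrow> w r * (\<Prod>c\<in>C. ?W (f c)))"
        using C f \<tau>_eq by (intro bexI[of _ "(C, f)"]) auto
    qed
  qed
  also have "\<dots> = (\<Sum>C\<in>N r. \<Sum>f\<in>PiE C (?Tr d). w r * (\<Prod>c\<in>C. ?W (f c)))"
    by (subst sum.Sigma) (use finN NL finT in \<open>auto intro!: finite_PiE\<close>)
  also have "\<dots> = w r * (\<Sum>C\<in>N r. \<Prod>c\<in>C. \<Sum>\<tau>\<in>?Tr d c. ?W \<tau>)"
    unfolding sum_distrib_left
    by (rule sum.cong[OF refl], subst prod_sum_PiE) (use NL finT in \<open>auto simp: sum_distrib_left\<close>)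
  also have "\<dots> \<le> w r * (\<Sum>C\<in>N r. \<Prod>c\<in>C. \<mu> c)"
  proof (intro mult_left_mono sum_mono prod_mono conjI w[OF r])
    fix C c assume "C \<in> N r" "c \<in> C"
    then have c: "c \<in> L" using NL(1) by blast
    show "0 \<le> (\<Sum>\<tau>\<in>?Tr d c. ?W \<tau>)" using W0[OF _ c] by (rule sum_nonneg)
    show "(\<Sum>\<tau>\<in>?Tr d c. ?W \<tau>) \<le> \<mu> c" using Suc.IH[OF c] .
  qed
  also have "\<dots> \<le> \<mu> r" using step[OF r] .
  finally show ?case .
qed

section \<open>Relations on pairs and elementary facts\<close>
definition shares_variable :: "'v element set \<times> nat \<Rightarrow> 'v element set \<times> nat \<Rightarrow> bool" where
  "shares_variable = (\<lambda>(Y, k) (Y', k'). sim Y Y')"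

definition shares_event ::
  "(nat \<Rightarrow> 'v element set set) \<Rightarrow> 'v element set \<times> nat \<Rightarrow> 'v element set \<times> nat \<Rightarrow> bool" where
  "shares_event \<B> = (\<lambda>(Y, k) (Y', k'). k = k' \<and> bowtie (\<B> k) Y Y')"

lemma shares_variableI: "sim Y (fst e) \<Longrightarrow> shares_variable (Y, k) e"
  by (cases e) (simp add: shares_variable_def)

lemma shares_if_common_event:
  "B \<in> \<B> k \<Longrightarrow> Y \<subseteq> B \<Longrightarrow> Z \<subseteq> B \<Longrightarrow>
    shares_variable (Y, k) (Z, k) \<or> shares_event \<B> (Y, k) (Z, k)"
  by (auto simp: shares_variable_def shares_event_def bowtie_def)

lemma sim_sym: "sim Y Y' \<Longrightarrow> sim Y' Y"
  by (auto simp: sim_def)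

lemma sim_iff_fst: "sim Y Y' \<longleftrightarrow> fst ` Y \<inter> fst ` Y' \<noteq> {}"
  by (force simp: sim_def)

lemma pmf_embed_finite:
  assumes A: "finite A" and nonneg: "\<And>x. x \<in> A \<Longrightarrow> 0 \<le> f x" and total: "(\<Sum>x\<in>A. f x) = 1"
  shows "pmf (embed_pmf (\<lambda>x. if x \<in> A then f x else 0)) y = (if y \<in> A then f y else 0)"
proof (rule pmf_embed_pmf)
  show "0 \<le> (if x \<in> A then f x else 0)" for x using nonneg by simp
  have "(\<integral>\<^sup>+x. ennreal (if x \<in> A then f x else 0) \<partial>count_space UNIV) = (\<Sum>x\<in>A. ennreal (f x))"
    by (subst nn_integral_count_space'[OF A]) auto
  also have "\<dots> = 1" using total by (subst sum_ennreal) (auto simp: nonneg)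
  finally show "(\<integral>\<^sup>+x. ennreal (if x \<in> A then f x else 0) \<partial>count_space UNIV) = 1" .
qed

lemma sum_at_most_one:
  fixes \<mu> :: "'b \<Rightarrow> real"
  assumes "finite I" "inj_on c I"
  shows "(\<Sum>A\<in>insert {} ((\<lambda>x. {c x}) ` I). \<Prod>e\<in>A. \<mu> e) = 1 + (\<Sum>x\<in>I. \<mu> (c x))"
proof -
  have "inj_on (\<lambda>x. {c x}) I" using assms(2) by (auto simp: inj_on_def)
  then show ?thesis
    using assms(1) by (subst sum.insert) (auto simp: sum.reindex)
qed

section \<open>The potential of a witness tree\<close>
locale partial_resampling =
  fixes n K :: nat
    and F :: "nat \<Rightarrow> 'v set"
    and p :: "'v element \<Rightarrow> real"
    and \<B> :: "nat \<Rightarrow> 'v element set set"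
    and Q :: "nat \<Rightarrow> 'v element set \<Rightarrow> real"
  assumes finite_values: "i \<in> {1..n} \<Longrightarrow> finite (F i)"
    and probability: "probability_vector n F p"
    and events_atomic: "k \<in> {1..K} \<Longrightarrow> \<B> k \<subseteq> atomic_sets n F"
    and hitting: "k \<in> {1..K} \<Longrightarrow> fractional_hitting_set n F (\<B> k) (Q k)"
begin

definition labels :: "('v element set \<times> nat) set" where
  "labels = atomic_sets n F \<times> {1..K}"

lemma labels_iff [simp]: "(Y, k) \<in> labels \<longleftrightarrow> Y \<in> atomic_sets n F \<and> k \<in> {1..K}"
  by (simp add: labels_def)

lemma finite_elements: "finite (elements n F)"
  unfolding elements_def by (intro finite_SigmaI finite_values) auto

lemma finite_atomic_sets: "finite (atomic_sets n F)"
  by (rule finite_subset[of _ "Pow (elements n F)"])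
     (auto simp: atomic_sets_def finite_elements)

lemma atomic_finite: "Y \<in> atomic_sets n F \<Longrightarrow> finite Y"
  by (auto simp: atomic_sets_def intro: finite_subset[OF _ finite_elements])

lemma atomic_vars: "Y \<in> atomic_sets n F \<Longrightarrow> fst ` Y \<subseteq> {1..n}"
  by (fastforce simp: atomic_sets_def elements_def)

lemma atomic_elementD:
  "Y \<in> atomic_sets n F \<Longrightarrow> (i, j) \<in> Y \<Longrightarrow> i \<in> {1..n} \<and> j \<in> F i"
  by (fastforce simp: atomic_sets_def elements_def)

lemma atomic_value_unique:
  "Y \<in> atomic_sets n F \<Longrightarrow> (i, j) \<in> Y \<Longrightarrow> (i, j') \<in> Y \<Longrightarrow> j = j'"
  unfolding atomic_sets_def using inj_onD[of fst Y "(i, j)" "(i, j')"] by simp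

lemma atomic_subset:
  "Y \<in> atomic_sets n F \<Longrightarrow> Z \<subseteq> Y \<Longrightarrow> Z \<noteq> {} \<Longrightarrow> Z \<in> atomic_sets n F"
  by (auto simp: atomic_sets_def intro: inj_on_subset)

lemma Q_nonneg: "k \<in> {1..K} \<Longrightarrow> Y \<in> atomic_sets n F \<Longrightarrow> 0 \<le> Q k Y"
  using hitting[of k] by (simp add: fractional_hitting_set_def)

lemma p_nonneg: "i \<in> {1..n} \<Longrightarrow> j \<in> F i \<Longrightarrow> 0 \<le> p (i, j)"
  using probability by (simp add: probability_vector_def elements_def)

lemma prod_p_nonneg: "Y \<in> atomic_sets n F \<Longrightarrow> 0 \<le> (\<Prod>x\<in>Y. p x)"
proof (rule prod_nonneg)
  fix x assume "Y \<in> atomic_sets n F" "x \<in> Y"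
  then show "0 \<le> p x" using atomic_elementD[of Y "fst x" "snd x"] p_nonneg[of "fst x" "snd x"]
    by simp
qed

sublocale witness_trees labels shares_variable "shares_event \<B>"
proof
  show "finite labels" using finite_atomic_sets by (simp add: labels_def)
  show "shares_variable e e" if "e \<in> labels" for e :: "'v element set \<times> nat"
    using that by (force simp: labels_def shares_variable_def sim_iff_fst atomic_sets_def)
qed (auto simp: shares_variable_def shares_event_def bowtie_def dest: sim_sym)

lemma pmf_var:
  assumes "i \<in> {1..n}"
  shows "pmf (var_pmf F p i) j = (if j \<in> F i then p (i, j) else 0)"
  unfolding var_pmf_def
  by (rule pmf_embed_finite[OF finite_values[OF assms] p_nonneg[OF assms]])
     (use probability assms in \<open>auto simp: probability_vector_def\<close>)

lemma set_var: "i \<in> {1..n} \<Longrightarrow> set_pmf (var_pmf F p i) \<subseteq> F i"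
  using pmf_var by (auto simp: set_pmf_iff split: if_splits)

definition mass :: "nat \<Rightarrow> 'v element set \<Rightarrow> real" where
  "mass k B = (\<Sum>Z | Z \<subseteq> B \<and> Z \<noteq> {}. Q k Z)"

lemma mass_ge_1: "k \<in> {1..K} \<Longrightarrow> B \<in> \<B> k \<Longrightarrow> 1 \<le> mass k B"
  using hitting[of k] by (simp add: fractional_hitting_set_def mass_def)

lemma pmf_subset:
  assumes k: "k \<in> {1..K}" and B: "B \<in> \<B> k"
  shows "pmf (subset_pmf (Q k) B) Y = (if Y \<subseteq> B \<and> Y \<noteq> {} then Q k Y / mass k B else 0)"
proof -
  have Ba: "B \<in> atomic_sets n F" using events_atomic[OF k] B by blast
  let ?A = "{Z. Z \<subseteq> B \<and> Z \<noteq> {}}"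
  have "finite ?A" using atomic_finite[OF Ba] by simp
  moreover have "0 \<le> Q k Z / mass k B" if "Z \<in> ?A" for Z
    using that Q_nonneg[OF k atomic_subset[OF Ba]] mass_ge_1[OF k B] by simp
  moreover have "(\<Sum>Z\<in>?A. Q k Z / mass k B) = 1"
    using mass_ge_1[OF k B] by (simp add: mass_def flip: sum_divide_distrib)
  ultimately have "pmf (embed_pmf (\<lambda>Z. if Z \<in> ?A then Q k Z / mass k B else 0)) Y =
      (if Y \<in> ?A then Q k Y / mass k B else 0)"
    by (rule pmf_embed_finite)
  then show ?thesis unfolding subset_pmf_def mass_def mem_Collect_eq .
qed

lemma set_subset:
  assumes "k \<in> {1..K}" "B \<in> \<B> k" "Y \<in> set_pmf (subset_pmf (Q k) B)"
  shows "Y \<subseteq> B" "Y \<in> atomic_sets n F"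
proof -
  have "Y \<subseteq> B \<and> Y \<noteq> {}"
    using assms(3) pmf_subset[OF assms(1,2)] by (auto simp: set_pmf_iff split: if_splits)
  then show "Y \<subseteq> B" "Y \<in> atomic_sets n F"
    using atomic_subset[of B Y] events_atomic[OF assms(1)] assms(2) by blast+
qed

text \<open>This is where the hitting-set condition enters: normalising by a mass of at least one only lowers the probability.\<close>
lemma emeasure_subset_le:
  assumes "k \<in> {1..K}" "B \<in> \<B> k" "Y \<subseteq> B" "Y \<noteq> {}"
  shows "emeasure (measure_pmf (subset_pmf (Q k) B)) {Y} \<le> ennreal (Q k Y)"
proof -
  have "B \<in> atomic_sets n F" using events_atomic[OF assms(1)] assms(2) by blast
  then have "0 \<le> Q k Y" using Q_nonneg[OF assms(1) atomic_subset] assms(3,4) by blast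
  then have "Q k Y / mass k B \<le> Q k Y / 1"
    using mass_ge_1[OF assms(1,2)] by (intro divide_left_mono) simp_all
  then show ?thesis
    using pmf_subset[OF assms(1,2), of Y] assms(3,4)
    by (simp add: emeasure_pmf_single ennreal_leI)
qed

text \<open>
  The occurrences of variable \<open>i\<close> in a tree, as pairs of a node and the value required there. Ordered by depth, the deepest
  first, these are the values that \<open>i\<close> must take in succession: now, and after each recorded resampling.
\<close>
definition demands :: "('v element set \<times> nat) list set \<Rightarrow> nat \<Rightarrow> (('v element set \<times> nat) list \<times> 'v) set" where
  "demands \<tau> i = {(v, j). v \<in> \<tau> \<and> (i, j) \<in> fst (hd v)}"

definition demand_prob :: "('v element set \<times> nat) list set \<Rightarrow> nat \<Rightarrow> ennreal" where
  "demand_prob \<tau> i = (\<Prod>(v, j)\<in>demands \<tau> i. ennreal (p (i, j)))"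

text \<open>
  The same probability once the present value \<open>y\<close> of variable \<open>i\<close> is known. The deepest node is the next one
  to look at the variable, so its demand has been settled by \<open>y\<close>. Writing this as a product, rather than dividing by \<open>p (i, y)\<close>, keeps
  values of probability zero harmless.
\<close>
definition demand_prob_given :: "('v element set \<times> nat) list set \<Rightarrow> nat \<Rightarrow> 'v \<Rightarrow> ennreal" where
  "demand_prob_given \<tau> i y =
     (\<Prod>(v, j)\<in>demands \<tau> i.
        if \<forall>(u, j')\<in>demands \<tau> i. length u \<le> length v then of_bool (y = j) else ennreal (p (i, j)))"

definition choice_prob :: "('v element set \<times> nat) list set \<Rightarrow> ennreal" where
  "choice_prob \<tau> = (\<Prod>v\<in>\<tau>. ennreal (Q (snd (hd v)) (fst (hd v))))"

definition potential :: "('v element set \<times> nat) list set \<Rightarrow> 'v config \<Rightarrow> ennreal" where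
  "potential \<tau> X = choice_prob \<tau> * (\<Prod>i\<in>{1..n}. demand_prob_given \<tau> i (X i))"

lemma wf_label:
  assumes "wf_tree \<tau>" "v \<in> \<tau>"
  shows "fst (hd v) \<in> atomic_sets n F" "snd (hd v) \<in> {1..K}"
  using wf_hd[OF assms] by (auto simp: labels_def mem_Times_iff)

lemma finite_demands:
  assumes "wf_tree \<tau>"
  shows "finite (demands \<tau> i)"
proof (rule finite_subset)
  show "demands \<tau> i \<subseteq> (SIGMA v:\<tau>. snd ` fst (hd v))"
    by (force simp: demands_def)
  show "finite (SIGMA v:\<tau>. snd ` fst (hd v))"
    using wf_finite[OF assms] wf_label[OF assms] atomic_finite by blast
qed

text \<open>Nodes of equal depth share no variable, so the demands on one variable are linearly ordered by depth.\<close>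
lemma demands_distinct_depths:
  assumes wf: "wf_tree \<tau>" and "(u, j') \<in> demands \<tau> i" "(v, j) \<in> demands \<tau> i" "length u = length v"
  shows "u = v \<and> j' = j"
proof -
  have *: "u \<in> \<tau>" "v \<in> \<tau>" "(i, j') \<in> fst (hd u)" "(i, j) \<in> fst (hd v)"
    using assms by (auto simp: demands_def)
  then have "shares_variable (hd u) (hd v)"
    by (cases "hd u"; cases "hd v") (auto simp: shares_variable_def sim_def)
  then have "u = v" using wf_level[OF wf *(1,2)] assms(4) by blast
  then show ?thesis using atomic_value_unique[OF wf_label(1)[OF wf *(2)]] * by blast
qed

lemma demand_prob_given_deepest:
  assumes wf: "wf_tree \<tau>" and top: "(v, j) \<in> demands \<tau> i"
    and max: "\<And>u j'. (u, j') \<in> demands \<tau> i \<Longrightarrow> length u \<le> length v"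
  shows "demand_prob_given \<tau> i y =
    of_bool (y = j) * (\<Prod>(u, j')\<in>demands \<tau> i - {(v, j)}. ennreal (p (i, j')))"
proof -
  have below: "\<not> (\<forall>(u', j'')\<in>demands \<tau> i. length u' \<le> length u)"
    if "(u, j') \<in> demands \<tau> i - {(v, j)}" for u j'
    using that top max[of u j'] demands_distinct_depths[OF wf, of u j' i v j] by fastforce
  have "demand_prob_given \<tau> i y = of_bool (y = j) *
    (\<Prod>(u, j')\<in>demands \<tau> i - {(v, j)}.
      if \<forall>(u', j'')\<in>demands \<tau> i. length u' \<le> length u then of_bool (y = j') else ennreal (p (i, j')))"
    unfolding demand_prob_given_def
    by (subst prod.remove[OF finite_demands[OF wf] top]) (use max in auto)
  also have "(\<Prod>(u, j')\<in>demands \<tau> i - {(v, j)}.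
      if \<forall>(u', j'')\<in>demands \<tau> i. length u' \<le> length u then of_bool (y = j') else ennreal (p (i, j')))
    = (\<Prod>(u, j')\<in>demands \<tau> i - {(v, j)}. ennreal (p (i, j')))"
  proof (rule prod.cong[OF refl])
    fix x assume x: "x \<in> demands \<tau> i - {(v, j)}"
    obtain u j' where uj: "x = (u, j')" by (cases x)
    show "(case x of (u, j') \<Rightarrow>
        if \<forall>(u', j'')\<in>demands \<tau> i. length u' \<le> length u then of_bool (y = j') else ennreal (p (i, j'))) =
      (case x of (u, j') \<Rightarrow> ennreal (p (i, j')))"
      unfolding uj prod.case using below[of u j'] x uj by (simp only: if_not_P if_False)
  qed
  finally show ?thesis .
qed

text \<open>Averaging over a fresh value pays for the demand of the deepest node.\<close>
lemma nn_integral_demand_prob_given: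
  assumes wf: "wf_tree \<tau>" and i: "i \<in> {1..n}"
  shows "(\<integral>\<^sup>+y. demand_prob_given \<tau> i y \<partial>measure_pmf (var_pmf F p i)) = demand_prob \<tau> i"
proof (cases "demands \<tau> i = {}")
  case True
  then show ?thesis by (simp add: demand_prob_given_def demand_prob_def)
next
  case False
  let ?len = "(\<lambda>(v, j). length v) ` demands \<tau> i"
  have "Max ?len \<in> ?len" using False finite_demands[OF wf] by (intro Max_in) auto
  then obtain v j where vj: "(v, j) \<in> demands \<tau> i" "length v = Max ?len" by auto
  have "length u \<le> length v" if "(u, j') \<in> demands \<tau> i" for u j'
    unfolding vj(2) using that finite_demands[OF wf] by (intro Max_ge) force+
  note top = demand_prob_given_deepest[OF wf vj(1) this]
  have "j \<in> F i" using vj(1) wf_label(1)[OF wf] atomic_elementD by (auto simp: demands_def)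
  then have single: "emeasure (measure_pmf (var_pmf F p i)) {j} = ennreal (p (i, j))"
    using pmf_var[OF i] by (simp add: emeasure_pmf_single)
  have "(\<integral>\<^sup>+y. demand_prob_given \<tau> i y \<partial>measure_pmf (var_pmf F p i)) =
    (\<integral>\<^sup>+y. (\<Prod>(u, j')\<in>demands \<tau> i - {(v, j)}. ennreal (p (i, j'))) * indicator {j} y
       \<partial>measure_pmf (var_pmf F p i))"
    by (intro nn_integral_cong) (simp add: top indicator_def)
  also have "\<dots> = (\<Prod>(u, j')\<in>demands \<tau> i - {(v, j)}. ennreal (p (i, j'))) * ennreal (p (i, j))"
    by (subst nn_integral_cmult_indicator) (simp_all add: single)
  also have "\<dots> = demand_prob \<tau> i"
    unfolding demand_prob_def
    by (subst prod.remove[OF finite_demands[OF wf] vj(1), where g = "\<lambda>(v, j). ennreal (p (i, j))"])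
       (simp add: mult.commute)
  finally show ?thesis .
qed

text \<open>
  A new node below everything that shares a variable with it takes over as the deepest occurrence of each of its
  variables; the demand of the former one has to be met by a later resampling.
\<close>
lemma demand_prob_insert_deepest:
  assumes wf: "wf_tree \<sigma>" and wf': "wf_tree (insert ((Y, k) # h) \<sigma>)" and fresh: "(Y, k) # h \<notin> \<sigma>"
    and Y: "Y \<in> atomic_sets n F"
    and deepest: "\<And>v. v \<in> \<sigma> \<Longrightarrow> sim Y (fst (hd v)) \<Longrightarrow> length v < length ((Y, k) # h)"
  shows "demand_prob_given (insert ((Y, k) # h) \<sigma>) i y =
    (if i \<in> fst ` Y then of_bool ((i, y) \<in> Y) * demand_prob \<sigma> i else demand_prob_given \<sigma> i y)"
proof (cases "i \<in> fst ` Y")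
  case True
  then obtain j where j: "(i, j) \<in> Y" by auto
  have value_iff: "(i, z) \<in> Y \<longleftrightarrow> z = j" for z
    using atomic_value_unique[OF Y j] j by blast
  have col: "demands (insert ((Y, k) # h) \<sigma>) i = insert ((Y, k) # h, j) (demands \<sigma> i)"
    unfolding demands_def by (auto simp only: value_iff insert_iff fst_conv list.sel mem_Collect_eq prod.case)
  have new: "((Y, k) # h, j) \<notin> demands \<sigma> i" using fresh by (auto simp: demands_def)
  have "length u \<le> length ((Y, k) # h)" if "(u, j') \<in> demands (insert ((Y, k) # h) \<sigma>) i" for u j'
  proof (cases "u = (Y, k) # h")
    case False
    then have "u \<in> \<sigma>" "(i, j') \<in> fst (hd u)" using that by (auto simp: demands_def)
    then show ?thesis using deepest[of u] j unfolding sim_def by (meson less_imp_le)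
  qed simp
  then show ?thesis
    using demand_prob_given_deepest[OF wf', of "(Y, k) # h" j i y] True
    by (simp add: col new value_iff demand_prob_def)
next
  case False
  then have "demands (insert ((Y, k) # h) \<sigma>) i = demands \<sigma> i"
    by (force simp: demands_def)
  then show ?thesis using False by (simp add: demand_prob_given_def)
qed

lemma nn_integral_resample_potential:
  assumes wf: "wf_tree \<sigma>" and Y: "Y \<in> atomic_sets n F"
  shows "(\<integral>\<^sup>+X'. potential \<sigma> X' \<partial>measure_pmf (resample F p Y X)) =
    choice_prob \<sigma> *
    (\<Prod>i\<in>{1..n}. if i \<in> fst ` Y then demand_prob \<sigma> i else demand_prob_given \<sigma> i (X i))"
proof -
  let ?V = "fst ` Y"
  let ?rest = "\<Prod>i\<in>{1..n} - ?V. demand_prob_given \<sigma> i (X i)"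
  note V = atomic_vars[OF Y]
  have split: "(\<Prod>i\<in>{1..n}. g i) = (\<Prod>i\<in>{1..n} - ?V. g i) * (\<Prod>i\<in>?V. g i)"
    for g :: "nat \<Rightarrow> ennreal"
    by (rule prod.subset_diff[OF V]) simp
  have "(\<integral>\<^sup>+X'. potential \<sigma> X' \<partial>measure_pmf (resample F p Y X)) =
    (\<integral>\<^sup>+Z. choice_prob \<sigma> * ?rest * (\<Prod>i\<in>?V. demand_prob_given \<sigma> i (Z i))
      \<partial>measure_pmf (Pi_pmf ?V undefined (var_pmf F p)))"
    unfolding resample_def nn_integral_map_pmf
    unfolding potential_def split mult.assoc
    by (intro nn_integral_cong arg_cong2[where f = "(*)"] prod.cong refl) auto
  also have "\<dots> = choice_prob \<sigma> * ?rest * (\<Prod>i\<in>?V. demand_prob \<sigma> i)"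
    by (subst nn_integral_cmult, simp, subst nn_integral_prod_Pi_pmf)
       (use V nn_integral_demand_prob_given[OF wf] atomic_finite[OF Y] in
         \<open>auto intro!: arg_cong2[where f = "(*)"] prod.cong\<close>)
  also have "\<dots> = choice_prob \<sigma> *
      (\<Prod>i\<in>{1..n}. if i \<in> ?V then demand_prob \<sigma> i else demand_prob_given \<sigma> i (X i))"
    unfolding split by (simp add: mult.assoc)
  finally show ?thesis .
qed

text \<open>A tree to which \<open>(Y, k)\<close> cannot be attached does not mention any variable of \<open>Y\<close>.\<close>
lemma resample_unrelated:
  assumes wf: "wf_tree \<tau>" and Y: "Y \<in> atomic_sets n F" and k: "k \<in> {1..K}"
    and unrelated: "attach (Y, k) \<tau> = \<tau>"
  shows "(\<integral>\<^sup>+X'. potential \<tau> X' \<partial>measure_pmf (resample F p Y X)) = potential \<tau> X"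
proof -
  have lab: "(Y, k) \<in> labels" using Y k by simp
  have none: "\<not> eligible \<tau> (Y, k) v" for v
    by (rule attach_cases[OF wf lab]) (use unrelated in auto)
  have "demands \<tau> i = {}" if "i \<in> fst ` Y" for i
  proof (rule ccontr)
    assume "demands \<tau> i \<noteq> {}"
    then obtain v where v: "v \<in> \<tau>" "i \<in> fst ` fst (hd v)" by (force simp: demands_def)
    then have "shares_variable (Y, k) (hd v)"
      using that by (intro shares_variableI) (auto simp: sim_iff_fst)
    then show False using none[of v] v(1) by (simp add: eligible_def)
  qed
  then have "(if i \<in> fst ` Y then demand_prob \<tau> i else demand_prob_given \<tau> i (X i)) =
      demand_prob_given \<tau> i (X i)" for i
    by (simp add: demand_prob_def demand_prob_given_def)
  then show ?thesis
    unfolding nn_integral_resample_potential[OF wf Y] unfolding potential_def by simp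
qed

text \<open>
  Undoing the earliest recorded resampling: its demand is met by the present values, its variables are
  then fresh for the rest of the tree, and what remains is the factor \<open>Q k Y\<close>.
\<close>
lemma resample_attached:
  assumes wf: "wf_tree \<sigma>" and Y: "Y \<in> atomic_sets n F" and k: "k \<in> {1..K}"
    and proper: "attach (Y, k) \<sigma> \<noteq> \<sigma>" and X: "holds_on Y X"
  shows "ennreal (Q k Y) * (\<integral>\<^sup>+X'. potential \<sigma> X' \<partial>measure_pmf (resample F p Y X)) =
    potential (attach (Y, k) \<sigma>) X"
proof -
  have lab: "(Y, k) \<in> labels" using Y k by simp
  obtain h where h: "attach (Y, k) \<sigma> = insert ((Y, k) # h) \<sigma>" "(Y, k) # h \<notin> \<sigma>"
    "\<And>v. eligible \<sigma> (Y, k) v \<Longrightarrow> length v < length ((Y, k) # h)"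
    by (rule attach_cases[OF wf lab]) (use proper in auto)
  have deepest: "length v < length ((Y, k) # h)" if "v \<in> \<sigma>" "sim Y (fst (hd v))" for v
    using h(3)[of v] that shares_variableI[of Y "hd v" k] by (simp add: eligible_def)
  have "demand_prob_given (insert ((Y, k) # h) \<sigma>) i (X i) =
      (if i \<in> fst ` Y then demand_prob \<sigma> i else demand_prob_given \<sigma> i (X i))" for i
    using demand_prob_insert_deepest[OF wf wf_attach[OF wf lab, unfolded h(1)] h(2) Y deepest, of i "X i"]
      X by (force simp: holds_on_def)
  moreover have "choice_prob (insert ((Y, k) # h) \<sigma>) = ennreal (Q k Y) * choice_prob \<sigma>"
    using h(2) wf_finite[OF wf] by (simp add: choice_prob_def)
  ultimately show ?thesis
    unfolding nn_integral_resample_potential[OF wf Y] h(1) unfolding potential_def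
    by (simp add: mult.assoc)
qed

text \<open>
  The supermartingale property. Each \<open>Y\<close> that may be drawn turns the tree \<open>\<sigma>\<close> of the remaining run into \<open>attach (Y, k) \<sigma>\<close>, and
  the sum collects the outcomes that lead to \<open>\<tau>\<close>. Any two subsets of \<open>B\<close> are related, by a common variable or by \<open>B\<close> itself. So, if
  some \<open>Y \<subseteq> B\<close> can be the earliest entry of \<open>\<tau>\<close>, no other subset contributes, and \<open>Y\<close> is drawn
  with probability at most \<open>Q k Y\<close>. Otherwise only \<open>\<sigma> = \<tau>\<close> contributes, for those \<open>Y\<close> that leave \<open>\<tau>\<close> untouched.
\<close>
lemma potential_step:
  assumes k: "k \<in> {1..K}" and B: "B \<in> \<B> k" and X: "holds_on B X"
    and \<tau>: "wf_tree \<tau>" "\<tau> \<noteq> {}"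
    and S: "finite S" "\<And>\<sigma>. \<sigma> \<in> S \<Longrightarrow> wf_tree \<sigma>"
  shows "(\<integral>\<^sup>+Y. (\<Sum>\<sigma>\<in>{\<sigma>\<in>S. attach (Y, k) \<sigma> = \<tau>}.
            \<integral>\<^sup>+X'. potential \<sigma> X' \<partial>measure_pmf (resample F p Y X)) \<partial>measure_pmf (subset_pmf (Q k) B))
         \<le> potential \<tau> X"
    (is "(\<integral>\<^sup>+Y. ?step Y \<partial>?P) \<le> _")
proof (cases "\<exists>Y \<sigma>. Y \<subseteq> B \<and> Y \<noteq> {} \<and> \<sigma> \<in> S \<and> attach (Y, k) \<sigma> = \<tau> \<and> \<sigma> \<noteq> \<tau>")
  case True
  then obtain Y \<sigma> where Y: "Y \<subseteq> B" "Y \<noteq> {}" and \<sigma>: "\<sigma> \<in> S" "attach (Y, k) \<sigma> = \<tau>" "\<sigma> \<noteq> \<tau>"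
    by blast
  have Ba: "B \<in> atomic_sets n F" using events_atomic[OF k] B by blast
  note Ya = atomic_subset[OF Ba Y]
  have unique: "Z = Y \<and> \<sigma>' = \<sigma>"
    if Z: "Z \<in> set_pmf (subset_pmf (Q k) B)" and \<sigma>': "\<sigma>' \<in> S" "attach (Z, k) \<sigma>' = \<tau>" for Z \<sigma>'
  proof -
    have lab: "(Y, k) \<in> labels" "(Z, k) \<in> labels"
      using Ya set_subset(2)[OF k B Z] k by simp_all
    have "(Z, k) = (Y, k) \<and> \<sigma>' = \<sigma>"
      by (rule attach_inj[OF S(2)[OF \<sigma>(1)] S(2)[OF \<sigma>'(1)] lab \<sigma>(2) \<sigma>'(2) \<sigma>(3)
        shares_if_common_event[of B \<B> k, OF B Y(1) set_subset(1)[OF k B Z]]])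
    then show ?thesis by blast
  qed
  let ?I = "\<integral>\<^sup>+X'. potential \<sigma> X' \<partial>measure_pmf (resample F p Y X)"
  have "?step Z \<le> ?I * indicator {Y} Z" if Z: "Z \<in> set_pmf (subset_pmf (Q k) B)" for Z
  proof (cases "Z = Y")
    case True
    have "{\<sigma>\<in>S. attach (Z, k) \<sigma> = \<tau>} = {\<sigma>}" using unique[OF Z] \<sigma> True by blast
    then show ?thesis using True by simp
  next
    case False
    then have "{\<sigma>\<in>S. attach (Z, k) \<sigma> = \<tau>} = {}" using unique[OF Z] by blast
    then show ?thesis by (simp only: sum.empty zero_le)
  qed
  then have "(\<integral>\<^sup>+Y. ?step Y \<partial>?P) \<le> (\<integral>\<^sup>+Z. ?I * indicator {Y} Z \<partial>?P)"
    by (rule nn_integral_mono_AE[OF AE_pmfI])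
  also have "\<dots> = ?I * emeasure ?P {Y}" by (rule nn_integral_cmult_indicator) simp
  also have "\<dots> \<le> ?I * ennreal (Q k Y)"
    by (intro mult_left_mono emeasure_subset_le k B Y) simp
  also have "\<dots> = potential \<tau> X"
  proof -
    have "attach (Y, k) \<sigma> \<noteq> \<sigma>" "holds_on Y X"
      using \<sigma>(2,3) X Y(1) by (blast, auto simp: holds_on_def)
    from resample_attached[OF S(2)[OF \<sigma>(1)] Ya k this] show ?thesis
      unfolding \<sigma>(2) by (simp only: mult.commute)
  qed
  finally show ?thesis .
next
  case False
  have "?step Y \<le> potential \<tau> X" if Y: "Y \<in> set_pmf (subset_pmf (Q k) B)" for Y
  proof -
    note Ya = set_subset[OF k B Y]
    have "Y \<noteq> {}" using Ya(2) by (simp add: atomic_sets_def)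
    then have only: "{\<sigma>\<in>S. attach (Y, k) \<sigma> = \<tau>} \<subseteq> {\<tau>}" using False Ya(1) by blast
    show ?thesis
    proof (cases "attach (Y, k) \<tau> = \<tau>")
      case True
      have "?step Y \<le> (\<Sum>\<sigma>\<in>{\<tau>}. \<integral>\<^sup>+X'. potential \<sigma> X' \<partial>measure_pmf (resample F p Y X))"
        using only by (intro sum_mono2) simp_all
      also have "\<dots> = potential \<tau> X" using resample_unrelated[OF \<tau>(1) Ya(2) k True] by simp
      finally show ?thesis .
    next
      case attached: False
      have "\<tau> \<notin> {\<sigma>\<in>S. attach (Y, k) \<sigma> = \<tau>}" using attached by simp
      then have "{\<sigma>\<in>S. attach (Y, k) \<sigma> = \<tau>} = {}" using only subset_singletonD by fastforce
      then show ?thesis by (simp only: sum.empty zero_le)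
    qed
  qed
  then have "(\<integral>\<^sup>+Y. ?step Y \<partial>?P) \<le> (\<integral>\<^sup>+Y. potential \<tau> X \<partial>?P)"
    by (rule nn_integral_mono_AE[OF AE_pmfI])
  then show ?thesis by simp
qed

section \<open>The loop\<close>
lemma potential_empty [simp]: "potential {} X = 1"
  by (simp add: potential_def choice_prob_def demand_prob_given_def demands_def)

lemma resample_config:
  assumes X: "X \<in> PiE {1..n} F" and Y: "Y \<in> atomic_sets n F"
    and X': "X' \<in> set_pmf (resample F p Y X)"
  shows "X' \<in> PiE {1..n} F"
proof -
  obtain Z where Z: "Z \<in> set_pmf (Pi_pmf (fst ` Y) undefined (var_pmf F p))"
    and X'_eq: "X' = override_on X Z (fst ` Y)"
    using X' by (auto simp: resample_def)
  have fin: "finite (fst ` Y)" using atomic_finite[OF Y] by simp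
  have "Z i \<in> F i" if i: "i \<in> fst ` Y" for i
  proof -
    have "Z i \<in> set_pmf (var_pmf F p i)"
      using Z i by (auto simp: set_Pi_pmf[OF fin] PiE_dflt_def)
    moreover have "i \<in> {1..n}" using i atomic_vars[OF Y] by blast
    ultimately show ?thesis using set_var by blast
  qed
  then show ?thesis
    using X atomic_vars[OF Y] unfolding X'_eq by (auto simp: PiE_iff override_on_def extensional_def)
qed

text \<open>
  Summation of the one-step estimate over all trees. The empty tree, of potential one, occurs only on the left, since
  attaching never produces it. This unit pays for the resampling just made.
\<close>
lemma potential_step_sum:
  assumes k: "k \<in> {1..K}" and B: "B \<in> \<B> k" and X: "holds_on B X"
  shows "(\<integral>\<^sup>+Y. \<integral>\<^sup>+X'. (\<Sum>\<sigma>\<in>grown N. potential \<sigma> X') \<partial>measure_pmf (resample F p Y X)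
            \<partial>measure_pmf (subset_pmf (Q k) B))
         \<le> (\<Sum>\<tau>\<in>grown (Suc N) - {{}}. potential \<tau> X)"
proof -
  let ?T = "grown (Suc N) - {{}}"
  let ?I = "\<lambda>Y \<sigma>. \<integral>\<^sup>+X'. potential \<sigma> X' \<partial>measure_pmf (resample F p Y X)"
  have regroup: "(\<Sum>\<sigma>\<in>grown N. ?I Y \<sigma>) =
      (\<Sum>\<tau>\<in>?T. \<Sum>\<sigma>\<in>{\<sigma>\<in>grown N. attach (Y, k) \<sigma> = \<tau>}. ?I Y \<sigma>)"
    if "Y \<in> set_pmf (subset_pmf (Q k) B)" for Y
  proof -
    have "(Y, k) \<in> labels" using set_subset(2)[OF k B that] k by simp
    then have "attach (Y, k) ` grown N \<subseteq> ?T"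
      by (intro image_subsetI DiffI attach_in_grown) simp_all
    from sum.group[OF finite_grown _ this, of "?I Y"] show ?thesis
      using finite_grown[of "Suc N"] by simp
  qed
  have "(\<integral>\<^sup>+Y. \<integral>\<^sup>+X'. (\<Sum>\<sigma>\<in>grown N. potential \<sigma> X') \<partial>measure_pmf (resample F p Y X)
            \<partial>measure_pmf (subset_pmf (Q k) B)) =
      (\<integral>\<^sup>+Y. (\<Sum>\<tau>\<in>?T. \<Sum>\<sigma>\<in>{\<sigma>\<in>grown N. attach (Y, k) \<sigma> = \<tau>}. ?I Y \<sigma>)
         \<partial>measure_pmf (subset_pmf (Q k) B))"
    by (rule nn_integral_cong_AE[OF AE_pmfI], subst nn_integral_sum) (simp, rule regroup)
  also have "\<dots> = (\<Sum>\<tau>\<in>?T. \<integral>\<^sup>+Y. (\<Sum>\<sigma>\<in>{\<sigma>\<in>grown N. attach (Y, k) \<sigma> = \<tau>}. ?I Y \<sigma>)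
         \<partial>measure_pmf (subset_pmf (Q k) B))"
    by (rule nn_integral_sum) simp
  also have "\<dots> \<le> (\<Sum>\<tau>\<in>?T. potential \<tau> X)"
  proof (rule sum_mono)
    fix \<tau> assume "\<tau> \<in> ?T"
    then have "wf_tree \<tau>" "\<tau> \<noteq> {}" using wf_grown by blast+
    then show "(\<integral>\<^sup>+Y. (\<Sum>\<sigma>\<in>{\<sigma>\<in>grown N. attach (Y, k) \<sigma> = \<tau>}. ?I Y \<sigma>)
        \<partial>measure_pmf (subset_pmf (Q k) B)) \<le> potential \<tau> X"
      by (rule potential_step[OF k B X _ _ finite_grown wf_grown])
  qed
  finally show ?thesis .
qed

text \<open>
  Besides divergence, a final configuration on which a bad event holds has infinite cost too. A finite expectation of this cost thus
  contains all the claims about the run.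
\<close>
definition stopping_cost :: "('v history \<times> 'v config) option \<Rightarrow> ennreal" where
  "stopping_cost r =
     (case r of None \<Rightarrow> \<infinity>
      | Some (h, X) \<Rightarrow> if avoids_all K \<B> X then of_nat (length h) else \<infinity>)"

text \<open>
  Induction on \<open>N\<close> along the unfolding of the loop, for an arbitrary history, because the selection rule may depend on it. One
  step lengthens the history by one, which is the potential of the empty tree.
\<close>
lemma truncated_cost_pra_loop:
  assumes sel: "valid_selection n F K \<B> sel"
  shows "X \<in> PiE {1..n} F \<Longrightarrow>
    (\<integral>\<^sup>+r. min (stopping_cost r) (of_nat (length h + N)) \<partial>measure_pmf (pra_loop F p K \<B> Q sel h X))
      \<le> of_nat (length h) + (\<Sum>\<tau>\<in>grown N - {{}}. potential \<tau> X)"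
proof (induction N arbitrary: h X)
  case 0
  have "(\<integral>\<^sup>+r. min (stopping_cost r) (of_nat (length h)) \<partial>measure_pmf (pra_loop F p K \<B> Q sel h X))
      \<le> (\<integral>\<^sup>+r. of_nat (length h) \<partial>measure_pmf (pra_loop F p K \<B> Q sel h X))"
    by (intro nn_integral_mono) simp
  then show ?case by simp
next
  case (Suc N)
  let ?cost = "\<lambda>r. min (stopping_cost r) (of_nat (length h + Suc N))"
  let ?bound = "\<Sum>\<tau>\<in>grown (Suc N) - {{}}. potential \<tau> X"
  show ?case
  proof (cases "avoids_all K \<B> X")
    case True
    then have "pra_loop F p K \<B> Q sel h X = return_spmf (h, X)"
      by (subst pra_loop.simps) simp
    then show ?thesis using True
      by (simp add: stopping_cost_def min.coboundedI1 add_increasing2)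
  next
    case False
    let ?next = "\<lambda>k B Y X'. pra_loop F p K \<B> Q sel ((X, k, B, Y) # h) X'"
    have unfold: "pra_loop F p K \<B> Q sel h X =
      bind_pmf (sel h X) (\<lambda>(k, B). bind_pmf (subset_pmf (Q k) B)
        (\<lambda>Y. bind_pmf (resample F p Y X) (?next k B Y)))"
      using False by (subst pra_loop.simps) simp
    have later: "(\<integral>\<^sup>+r. ?cost r \<partial>measure_pmf (?next k B Y X')) \<le>
        of_nat (length h) + (\<Sum>\<sigma>\<in>grown N. potential \<sigma> X')"
      if "X' \<in> PiE {1..n} F" for k B Y X'
    proof -
      have "(\<integral>\<^sup>+r. ?cost r \<partial>measure_pmf (?next k B Y X')) \<le>
          of_nat (Suc (length h)) + (\<Sum>\<sigma>\<in>grown N - {{}}. potential \<sigma> X')"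
        using Suc.IH[OF that, of "(X, k, B, Y) # h"] by simp
      also have "\<dots> = of_nat (length h) + (\<Sum>\<sigma>\<in>grown N. potential \<sigma> X')"
        by (subst sum.remove[OF finite_grown empty_in_grown]) (simp add: ac_simps)
      finally show ?thesis .
    qed
    have step: "(\<integral>\<^sup>+Y. \<integral>\<^sup>+X'. \<integral>\<^sup>+r. ?cost r \<partial>measure_pmf (?next k B Y X')
        \<partial>measure_pmf (resample F p Y X) \<partial>measure_pmf (subset_pmf (Q k) B))
        \<le> of_nat (length h) + ?bound"
      if kB: "(k, B) \<in> set_pmf (sel h X)" for k B
    proof -
      have kB': "k \<in> {1..K}" "B \<in> \<B> k" "holds_on B X"
        using sel kB False Suc.prems unfolding valid_selection_def by blast+
      have "(\<integral>\<^sup>+Y. \<integral>\<^sup>+X'. \<integral>\<^sup>+r. ?cost r \<partial>measure_pmf (?next k B Y X')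
          \<partial>measure_pmf (resample F p Y X) \<partial>measure_pmf (subset_pmf (Q k) B)) \<le>
        (\<integral>\<^sup>+Y. \<integral>\<^sup>+X'. of_nat (length h) + (\<Sum>\<sigma>\<in>grown N. potential \<sigma> X')
          \<partial>measure_pmf (resample F p Y X) \<partial>measure_pmf (subset_pmf (Q k) B))"
      proof (rule nn_integral_mono_AE[OF AE_pmfI], rule nn_integral_mono_AE[OF AE_pmfI])
        fix Y X'
        assume "Y \<in> set_pmf (subset_pmf (Q k) B)" "X' \<in> set_pmf (resample F p Y X)"
        then have "X' \<in> PiE {1..n} F"
          using resample_config[OF Suc.prems] set_subset(2)[OF kB'(1,2)] by blast
        then show "(\<integral>\<^sup>+r. ?cost r \<partial>measure_pmf (?next k B Y X')) \<le>
            of_nat (length h) + (\<Sum>\<sigma>\<in>grown N. potential \<sigma> X')"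
          by (rule later)
      qed
      also have "\<dots> = of_nat (length h) +
          (\<integral>\<^sup>+Y. \<integral>\<^sup>+X'. (\<Sum>\<sigma>\<in>grown N. potential \<sigma> X')
            \<partial>measure_pmf (resample F p Y X) \<partial>measure_pmf (subset_pmf (Q k) B))"
        by (simp add: nn_integral_add)
      also have "\<dots> \<le> of_nat (length h) + ?bound"
        by (intro add_left_mono potential_step_sum kB')
      finally show ?thesis .
    qed
    have "(\<integral>\<^sup>+r. ?cost r \<partial>measure_pmf (pra_loop F p K \<B> Q sel h X)) =
      (\<integral>\<^sup>+x. (case x of (k, B) \<Rightarrow> \<integral>\<^sup>+Y. \<integral>\<^sup>+X'. \<integral>\<^sup>+r. ?cost r \<partial>measure_pmf (?next k B Y X')
        \<partial>measure_pmf (resample F p Y X) \<partial>measure_pmf (subset_pmf (Q k) B)) \<partial>measure_pmf (sel h X))"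
      unfolding unfold nn_integral_bind_pmf
      by (intro nn_integral_cong) (simp split: prod.split)
    also have "\<dots> \<le> (\<integral>\<^sup>+x. of_nat (length h) + ?bound \<partial>measure_pmf (sel h X))"
    proof (rule nn_integral_mono_AE[OF AE_pmfI])
      fix x assume x: "x \<in> set_pmf (sel h X)"
      obtain k B where kB: "x = (k, B)" by (cases x)
      show "(case x of (k, B) \<Rightarrow> \<integral>\<^sup>+Y. \<integral>\<^sup>+X'. \<integral>\<^sup>+r. ?cost r \<partial>measure_pmf (?next k B Y X')
        \<partial>measure_pmf (resample F p Y X) \<partial>measure_pmf (subset_pmf (Q k) B))
        \<le> of_nat (length h) + ?bound"
        unfolding kB prod.case by (rule step[OF x[unfolded kB]])
    qed
    finally show ?thesis by simp
  qed
qed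

lemma nn_integral_initial_potential:
  assumes wf: "wf_tree \<tau>"
  shows "(\<integral>\<^sup>+X. potential \<tau> X \<partial>measure_pmf (Pi_pmf {1..n} undefined (var_pmf F p))) =
    ennreal (\<Prod>v\<in>\<tau>. (\<Prod>x\<in>fst (hd v). p x) * Q (snd (hd v)) (fst (hd v)))"
proof -
  note label = wf_label[OF wf]
  have "(\<integral>\<^sup>+X. potential \<tau> X \<partial>measure_pmf (Pi_pmf {1..n} undefined (var_pmf F p))) =
      choice_prob \<tau> * (\<Prod>i\<in>{1..n}. demand_prob \<tau> i)"
    unfolding potential_def
    by (subst nn_integral_cmult, simp, subst nn_integral_prod_Pi_pmf)
       (simp_all add: nn_integral_demand_prob_given[OF wf])
  also have "(\<Prod>i\<in>{1..n}. demand_prob \<tau> i) =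
      (\<Prod>(i, v, j)\<in>(SIGMA i:{1..n}. demands \<tau> i). ennreal (p (i, j)))"
    unfolding demand_prob_def by (rule prod.Sigma) (simp_all add: finite_demands[OF wf])
  also have "\<dots> = (\<Prod>(v, x)\<in>(SIGMA v:\<tau>. fst (hd v)). ennreal (p x))"
    by (rule prod.reindex_bij_witness[where j = "\<lambda>(i, v, j). (v, (i, j))" and i = "\<lambda>(v, (i, j)). (i, v, j)"])
       (use atomic_elementD[OF label(1)] in \<open>auto simp: demands_def\<close>)
  also have "\<dots> = (\<Prod>v\<in>\<tau>. \<Prod>x\<in>fst (hd v). ennreal (p x))"
    by (rule prod.Sigma[symmetric]) (use wf_finite[OF wf] atomic_finite[OF label(1)] in auto)
  also have "\<dots> = (\<Prod>v\<in>\<tau>. ennreal (\<Prod>x\<in>fst (hd v). p x))"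
  proof (rule prod.cong[OF refl], rule prod_ennreal)
    fix v x assume "v \<in> \<tau>" "x \<in> fst (hd v)"
    then show "0 \<le> p x"
      using atomic_elementD[OF label(1), of v "fst x" "snd x"] p_nonneg[of "fst x" "snd x"] by simp
  qed
  also have "choice_prob \<tau> * \<dots> =
      (\<Prod>v\<in>\<tau>. ennreal ((\<Prod>x\<in>fst (hd v). p x) * Q (snd (hd v)) (fst (hd v))))"
    unfolding choice_prob_def prod.distrib[symmetric]
    by (intro prod.cong refl)
       (simp add: ennreal_mult' prod_p_nonneg label Q_nonneg mult.commute)
  also have "\<dots> = ennreal (\<Prod>v\<in>\<tau>. (\<Prod>x\<in>fst (hd v). p x) * Q (snd (hd v)) (fst (hd v)))"
    by (intro prod_ennreal mult_nonneg_nonneg prod_p_nonneg Q_nonneg label)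
  finally show ?thesis .
qed

text \<open>
  The three conditions on good neighbour sets are the invariants of witness trees: children are related to their
  parent, siblings have the same depth, and weak children are unique.
\<close>
lemma grown_branching:
  assumes \<tau>: "\<tau> \<in> grown N" and ne: "\<tau> \<noteq> {}"
  shows "\<exists>r\<in>labels. \<tau> \<in> branching_trees (\<lambda>(Y, k). GNS n F K \<B> Y k) N r"
proof -
  note wf = wf_grown[OF \<tau>]
  obtain v0 where v0: "v0 \<in> \<tau>" using ne by blast
  let ?r = "last v0"
  have root: "[?r] \<in> \<tau>" using wf_root_in[OF wf v0] .
  have children: "{c. c # v \<in> \<tau>} \<in> GNS n F K \<B> Y k"
    if v: "v \<in> \<tau>" and Yk: "hd v = (Y, k)" for v Y k
  proof -
    have vn: "v \<noteq> []" using wf_node(1)[OF wf v] .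
    have related: "sim Z Y \<or> l = k \<and> bowtie (\<B> k) Z Y" if "(Z, l) # v \<in> \<tau>" for Z l
      using wf_child[OF wf that vn] unfolding Yk
      by (auto simp: shares_variable_def shares_event_def)
    have level: "\<not> sim Z Z'"
      if "(Z, l) # v \<in> \<tau>" "(Z', l') # v \<in> \<tau>" "(Z, l) \<noteq> (Z', l')" for Z l Z' l'
      using wf_level[OF wf that(1,2)] that(3) by (simp add: shares_variable_def)
    have one: "Z = Z'"
      if "(Z, k) # v \<in> \<tau>" "(Z', k) # v \<in> \<tau>" "bowtie (\<B> k) Z Y" "bowtie (\<B> k) Z' Y" for Z Z'
      using wf_weak_child[OF wf that(1,2) vn] that(3,4) unfolding Yk
      by (simp add: shares_event_def)
    have "c \<in> labels" if "c # v \<in> \<tau>" for c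
      using wf_hd[OF wf that] by simp
    then have "{c. c # v \<in> \<tau>} \<subseteq> atomic_sets n F \<times> {1..K}"
      unfolding labels_def by blast
    then show ?thesis
      unfolding GNS_def mem_Collect_eq
      using related level one by (intro conjI) blast+
  qed
  have "\<tau> \<in> branching_trees (\<lambda>(Y, k). GNS n F K \<B> Y k) N ?r"
    unfolding branching_trees_def mem_Collect_eq
  proof (intro conjI ballI allI impI)
    fix v assume v: "v \<in> \<tau>"
    show "{c. c # v \<in> \<tau>} \<in> (case hd v of (Y, k) \<Rightarrow> GNS n F K \<B> Y k)"
      using children[OF v] by (cases "hd v") simp
  qed (use root wf_node(1)[OF wf] wf_root[OF wf _ v0] length_grown[OF \<tau>] wf_parent[OF wf] in blast)+
  then show ?thesis using wf_hd[OF wf root] by (auto simp del: labels_iff)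
qed

abbreviation weight :: "'v element set \<times> nat \<Rightarrow> real" where
  "weight e \<equiv> (\<Prod>x\<in>fst e. p x) * Q (snd e) (fst e)"

lemma weight_nonneg: "e \<in> labels \<Longrightarrow> 0 \<le> weight e"
  by (intro mult_nonneg_nonneg prod_p_nonneg Q_nonneg) (auto simp: labels_def)

lemma sum_grown_le:
  fixes \<mu> :: "'v element set \<times> nat \<Rightarrow> real"
  assumes \<mu>: "\<And>e. e \<in> labels \<Longrightarrow> 0 \<le> \<mu> e"
    and step: "\<And>Y k. Y \<in> atomic_sets n F \<Longrightarrow> k \<in> {1..K} \<Longrightarrow>
      weight (Y, k) * (\<Sum>T\<in>GNS n F K \<B> Y k. \<Prod>e\<in>T. \<mu> e) \<le> \<mu> (Y, k)"
  shows "(\<Sum>\<tau>\<in>grown N - {{}}. \<Prod>v\<in>\<tau>. weight (hd v)) \<le> (\<Sum>e\<in>labels. \<mu> e)"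
proof -
  let ?N = "\<lambda>(Y, k). GNS n F K \<B> Y k"
  let ?W = "\<lambda>\<tau>. \<Prod>v\<in>\<tau>. weight (hd v)"
  have N: "?N e \<subseteq> Pow labels" for e by (cases e) (auto simp: GNS_def labels_def)
  have fin: "finite (branching_trees ?N N r)" if "r \<in> labels" for r
    using finite_branching_trees[OF finite_labels N that] .
  have W0: "0 \<le> ?W \<tau>" if "\<tau> \<in> branching_trees ?N N r" "r \<in> labels" for \<tau> r
  proof (rule prod_nonneg)
    fix v assume v: "v \<in> \<tau>"
    have "set v \<subseteq> labels" by (rule branching_trees_labels[OF N that(2,1) v])
    moreover have "v \<noteq> []" using that(1) v by (simp add: branching_trees_def)
    ultimately have "hd v \<in> labels" by (cases v) auto
    then show "0 \<le> weight (hd v)" by (rule weight_nonneg)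
  qed
  have "(\<Sum>\<tau>\<in>grown N - {{}}. ?W \<tau>) \<le> (\<Sum>(r, \<tau>)\<in>(SIGMA r:labels. branching_trees ?N N r). ?W \<tau>)"
  proof (rule sum_le_included[where i = snd])
    show "finite (grown N - {{}})" using finite_grown by simp
    show "finite (SIGMA r:labels. branching_trees ?N N r)"
      using finite_labels fin by (rule finite_SigmaI)
    show "\<forall>y\<in>(SIGMA r:labels. branching_trees ?N N r). 0 \<le> (case y of (r, \<tau>) \<Rightarrow> ?W \<tau>)"
      using W0 by (clarsimp simp del: labels_iff)
    show "\<forall>\<tau>\<in>grown N - {{}}. \<exists>y\<in>(SIGMA r:labels. branching_trees ?N N r).
        snd y = \<tau> \<and> ?W \<tau> \<le> (case y of (r, \<tau>) \<Rightarrow> ?W \<tau>)"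
    proof
      fix \<tau> assume "\<tau> \<in> grown N - {{}}"
      then obtain r where "r \<in> labels" "\<tau> \<in> branching_trees ?N N r"
        using grown_branching by blast
      then show "\<exists>y\<in>(SIGMA r:labels. branching_trees ?N N r).
          snd y = \<tau> \<and> ?W \<tau> \<le> (case y of (r, \<tau>) \<Rightarrow> ?W \<tau>)"
        by (intro bexI[of _ "(r, \<tau>)"]) auto
    qed
  qed
  also have "\<dots> = (\<Sum>r\<in>labels. \<Sum>\<tau>\<in>branching_trees ?N N r. ?W \<tau>)"
    by (rule sum.Sigma[symmetric]) (use finite_labels fin in blast)+
  also have "\<dots> \<le> (\<Sum>e\<in>labels. \<mu> e)"
  proof (rule sum_mono)
    fix r assume r: "r \<in> labels"
    show "(\<Sum>\<tau>\<in>branching_trees ?N N r. ?W \<tau>) \<le> \<mu> r"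
    proof (rule sum_branching_trees_le[OF finite_labels N weight_nonneg \<mu> _ r])
      fix e :: "'v element set \<times> nat" assume "e \<in> labels"
      then show "weight e * (\<Sum>T\<in>?N e. \<Prod>c\<in>T. \<mu> c) \<le> \<mu> e"
        using step[of "fst e" "snd e"] by (cases e) simp
    qed
  qed
  finally show ?thesis .
qed

section \<open>The three criteria\<close>

text \<open>
  At the start all variables are fresh, so the expected potential of a tree is its weight, and the truncated costs are
  bounded uniformly in \<open>N\<close>. Letting \<open>N\<close> grow bounds the expectation of \<open>stopping_cost\<close> itself.
\<close>
lemma good_neighbour_criterion:
  fixes \<mu> :: "'v element set \<times> nat \<Rightarrow> real"
  assumes sel: "valid_selection n F K \<B> sel"
    and \<mu>: "\<And>e. e \<in> labels \<Longrightarrow> 0 \<le> \<mu> e"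
    and step: "\<And>Y k. Y \<in> atomic_sets n F \<Longrightarrow> k \<in> {1..K} \<Longrightarrow>
      weight (Y, k) * (\<Sum>T\<in>GNS n F K \<B> Y k. \<Prod>e\<in>T. \<mu> e) \<le> \<mu> (Y, k)"
  shows "terminates_avoiding K \<B> (pra_multi n F p K \<B> Q sel) \<and>
    expected_resamplings (pra_multi n F p K \<B> Q sel) \<le> ennreal (\<Sum>e\<in>labels. \<mu> e)"
proof -
  let ?run = "pra_multi n F p K \<B> Q sel"
  let ?init = "Pi_pmf {1..n} undefined (var_pmf F p)"
  let ?C = "\<Sum>e\<in>labels. \<mu> e"
  have truncated: "(\<integral>\<^sup>+r. min (stopping_cost r) (of_nat N) \<partial>measure_pmf ?run) \<le> ennreal ?C" for N
  proof -
    have "(\<integral>\<^sup>+r. min (stopping_cost r) (of_nat N) \<partial>measure_pmf ?run) =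
      (\<integral>\<^sup>+X. \<integral>\<^sup>+r. min (stopping_cost r) (of_nat N) \<partial>measure_pmf (pra_loop F p K \<B> Q sel [] X)
        \<partial>measure_pmf ?init)"
      by (simp add: pra_multi_def)
    also have "\<dots> \<le> (\<integral>\<^sup>+X. (\<Sum>\<tau>\<in>grown N - {{}}. potential \<tau> X) \<partial>measure_pmf ?init)"
    proof (rule nn_integral_mono_AE[OF AE_pmfI])
      fix X assume "X \<in> set_pmf ?init"
      then have "X \<in> PiE {1..n} F"
        using set_var by (force simp: set_Pi_pmf PiE_dflt_def PiE_iff extensional_def)
      from truncated_cost_pra_loop[OF sel this, of "[]" N]
      show "(\<integral>\<^sup>+r. min (stopping_cost r) (of_nat N) \<partial>measure_pmf (pra_loop F p K \<B> Q sel [] X)) \<le>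
          (\<Sum>\<tau>\<in>grown N - {{}}. potential \<tau> X)"
        by simp
    qed
    also have "\<dots> = (\<Sum>\<tau>\<in>grown N - {{}}. ennreal (\<Prod>v\<in>\<tau>. weight (hd v)))"
      by (subst nn_integral_sum, simp, rule sum.cong[OF refl])
         (use wf_grown in \<open>blast intro: nn_integral_initial_potential\<close>)
    also have "\<dots> = ennreal (\<Sum>\<tau>\<in>grown N - {{}}. \<Prod>v\<in>\<tau>. weight (hd v))"
      using wf_grown wf_hd weight_nonneg by (intro sum_ennreal prod_nonneg) blast
    also have "\<dots> \<le> ennreal ?C"
      by (intro ennreal_leI sum_grown_le \<mu> step)
    finally show ?thesis .
  qed
  have "incseq (\<lambda>N r. min (stopping_cost r) (of_nat N))"
    unfolding incseq_def le_fun_def by (intro allI impI min.mono order_refl of_nat_mono)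
  moreover have "(SUP N. min (stopping_cost r) (of_nat N)) = stopping_cost r" for r
  proof (rule antisym)
    show "(SUP N. min (stopping_cost r) (of_nat N)) \<le> stopping_cost r"
      by (intro SUP_least) simp
    show "stopping_cost r \<le> (SUP N. min (stopping_cost r) (of_nat N))"
    proof (cases "stopping_cost r = top")
      case True
      then show ?thesis by (simp add: ennreal_SUP_of_nat_eq_top)
    next
      case False
      then obtain N where "stopping_cost r < of_nat N"
        using ennreal_Ex_less_of_nat[of "stopping_cost r"] by (auto simp: top.not_eq_extremum)
      then show ?thesis by (intro SUP_upper2[of N]) simp_all
    qed
  qed
  ultimately have "(\<integral>\<^sup>+r. stopping_cost r \<partial>measure_pmf ?run) =
      (SUP N. \<integral>\<^sup>+r. min (stopping_cost r) (of_nat N) \<partial>measure_pmf ?run)"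
    using nn_integral_monotone_convergence_SUP[of "\<lambda>N r. min (stopping_cost r) (of_nat N)" "measure_pmf ?run"]
    by simp
  then have cost: "(\<integral>\<^sup>+r. stopping_cost r \<partial>measure_pmf ?run) \<le> ennreal ?C"
    using truncated by (simp add: SUP_least)
  then have "(\<integral>\<^sup>+r. stopping_cost r \<partial>measure_pmf ?run) \<noteq> \<infinity>"
    by (auto simp: top_unique)
  then have "AE r in measure_pmf ?run. stopping_cost r \<noteq> \<infinity>"
    by (intro nn_integral_PInf_AE) simp_all
  then have finite_cost: "stopping_cost r \<noteq> \<infinity>" if "r \<in> set_pmf ?run" for r
    using that by (simp add: AE_measure_pmf_iff)
  have "None \<notin> set_pmf ?run"
    using finite_cost[of None] by (auto simp: stopping_cost_def)
  moreover have "avoids_all K \<B> X" if "(h, X) \<in> set_spmf ?run" for h X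
    using finite_cost[of "Some (h, X)"] that
    by (auto simp: stopping_cost_def in_set_spmf split: if_splits)
  ultimately have "terminates_avoiding K \<B> ?run"
    by (auto simp: terminates_avoiding_def lossless_iff_set_pmf_None)
  moreover have "expected_resamplings ?run \<le> (\<integral>\<^sup>+r. stopping_cost r \<partial>measure_pmf ?run)"
    unfolding expected_resamplings_def
    by (intro nn_integral_mono) (auto simp: stopping_cost_def split: option.splits)
  ultimately show ?thesis using cost by auto
qed

lemma finite_GNS: "finite (GNS n F K \<B> Y k)"
proof (rule finite_subset)
  show "GNS n F K \<B> Y k \<subseteq> Pow labels" by (auto simp: GNS_def labels_def)
qed (simp add: finite_labels)

text \<open>
  A good neighbour set contains at most one pair \<open>(Y', k')\<close> for each \<open>Y'\<close> with \<open>sim Y' Y\<close>, since \<open>sim Y' Y'\<close>. Its other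
  members are \<open>bowtie\<close> neighbours with index \<open>k\<close>, and there is at most one. Choosing nothing or a single entry in each
  row and expanding the product gives every good neighbour set.
\<close>
lemma sum_GNS_le:
  fixes \<mu> :: "'v element set \<times> nat \<Rightarrow> real"
  assumes Y: "Y \<in> atomic_sets n F" and k: "k \<in> {1..K}"
    and \<mu>: "\<And>e. e \<in> labels \<Longrightarrow> 0 \<le> \<mu> e"
  shows "(\<Sum>T\<in>GNS n F K \<B> Y k. \<Prod>e\<in>T. \<mu> e) \<le>
    (\<Prod>Y'\<in>{Y'\<in>atomic_sets n F. sim Y' Y}. 1 + (\<Sum>k'\<in>{1..K}. \<mu> (Y', k'))) *
    (1 + (\<Sum>Y''\<in>{Y''\<in>atomic_sets n F. bowtie (\<B> k) Y'' Y}. \<mu> (Y'', k)))"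
proof -
  define S where "S = {Y'\<in>atomic_sets n F. sim Y' Y}"
  define W where "W = {Y''\<in>atomic_sets n F. bowtie (\<B> k) Y'' Y}"
  \<comment> \<open>The possible rows of a good neighbour set, as sets of at most one pair: \<open>R Y'\<close> for \<open>Y' \<in> S\<close>, and \<open>R2\<close> for the \<open>bowtie\<close> part.\<close>
  define R where "R = (\<lambda>Y' :: 'v element set. insert {} ((\<lambda>k'. {(Y', k')}) ` {1..K}))"
  define R2 where "R2 = insert {} ((\<lambda>Y''. {(Y'', k)}) ` W)"
  let ?P = "\<lambda>A. \<Prod>e\<in>A. \<mu> e"
  define join :: "_ \<Rightarrow> ('v element set \<times> nat) set"
    where "join = (\<lambda>(f :: 'v element set \<Rightarrow> _, A). (\<Union>Y'\<in>S. f Y') \<union> A)"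
  have finS: "finite S" "finite W" using finite_atomic_sets by (simp_all add: S_def W_def)
  have finR: "finite (R Y')" "finite R2" for Y' using finS by (simp_all add: R_def R2_def)
  have R_pos: "0 \<le> ?P A" if "A \<in> R Y'" "Y' \<in> S" for A Y'
    using that \<mu> by (auto simp: R_def S_def)
  have R2_pos: "0 \<le> ?P A" if "A \<in> R2" for A
    using that \<mu> k by (auto simp: R2_def W_def)
  have "(\<Sum>T\<in>GNS n F K \<B> Y k. ?P T) \<le>
      (\<Sum>(f, A)\<in>PiE S R \<times> R2. (\<Prod>Y'\<in>S. ?P (f Y')) * ?P A)"
  proof (rule sum_le_included[where i = join])
    show "finite (GNS n F K \<B> Y k)" by (rule finite_GNS)
    show "finite (PiE S R \<times> R2)" using finS finR by (intro finite_cartesian_product finite_PiE)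
    show "\<forall>y\<in>PiE S R \<times> R2. 0 \<le> (case y of (f, A) \<Rightarrow> (\<Prod>Y'\<in>S. ?P (f Y')) * ?P A)"
    proof (clarify, rule mult_nonneg_nonneg)
      fix f A assume f: "f \<in> PiE S R" and A: "A \<in> R2"
      show "0 \<le> ?P A" using R2_pos[OF A] .
      show "0 \<le> (\<Prod>Y'\<in>S. ?P (f Y'))"
        by (rule prod_nonneg) (rule R_pos[OF PiE_mem[OF f]])
    qed
    show "\<forall>T\<in>GNS n F K \<B> Y k. \<exists>y\<in>PiE S R \<times> R2. join y = T \<and>
        ?P T \<le> (case y of (f, A) \<Rightarrow> (\<Prod>Y'\<in>S. ?P (f Y')) * ?P A)"
    proof
      fix T assume T: "T \<in> GNS n F K \<B> Y k"
      note GNS = T[unfolded GNS_def mem_Collect_eq]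
      have sub: "Z \<in> atomic_sets n F \<and> l \<in> {1..K}" if "(Z, l) \<in> T" for Z l
        using GNS[THEN conjunct1] that by blast
      have related: "sim Z Y \<or> l = k \<and> bowtie (\<B> k) Z Y" if "(Z, l) \<in> T" for Z l
        using GNS[THEN conjunct2, THEN conjunct1] that by blast
      have indep: "\<not> sim Z Z'" if "(Z, l) \<in> T" "(Z', l') \<in> T" "(Z, l) \<noteq> (Z', l')" for Z l Z' l'
      proof -
        note level = GNS[THEN conjunct2, THEN conjunct2, THEN conjunct1]
        have "\<forall>(Z', l')\<in>T. (Z, l) \<noteq> (Z', l') \<longrightarrow> \<not> sim Z Z'"
          using bspec[OF level that(1)] unfolding prod.case .
        from bspec[OF this that(2)] that(3) show ?thesis by simp
      qed
      have one: "Z = Z'" if "(Z, k) \<in> T" "(Z', k) \<in> T" "bowtie (\<B> k) Z Y" "bowtie (\<B> k) Z' Y"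
        for Z Z'
        using GNS[THEN conjunct2, THEN conjunct2, THEN conjunct2] that by blast
      have "finite T"
        using sub by (intro finite_subset[OF _ finite_labels]) (auto simp: labels_def)
      have self: "sim Z Z" if "(Z, l) \<in> T" for Z l
        using sub[OF that] by (force simp: sim_iff_fst atomic_sets_def)
      define f where "f = (\<lambda>Y'\<in>S. {e\<in>T. fst e = Y'})"
      define A where "A = {e\<in>T. fst e \<notin> S}"
      have "{e\<in>T. fst e = Y'} \<in> R Y'" for Y'
      proof (cases "\<exists>l. (Y', l) \<in> T")
        case True
        then obtain l where l: "(Y', l) \<in> T" by blast
        have "{e\<in>T. fst e = Y'} = {(Y', l)}"
          using l indep[OF l] self[OF l] by force
        then show ?thesis using sub[OF l] by (auto simp: R_def)
      next
        case False
        then have "{e\<in>T. fst e = Y'} = {}" by force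
        then show ?thesis by (simp add: R_def)
      qed
      then have f: "f \<in> PiE S R" by (auto simp: f_def)
      have A: "A \<in> R2"
      proof (cases "A = {}")
        case False
        then obtain Z l where Zl: "(Z, l) \<in> A" by force
        have weak: "l' = k \<and> bowtie (\<B> k) Z' Y \<and> (Z', k) \<in> T" if "(Z', l') \<in> A" for Z' l'
          using that related[of Z' l'] sub[of Z' l'] by (auto simp: A_def S_def)
        have "A = {(Z, k)}"
        proof (intro equalityI subsetI)
          fix e assume e: "e \<in> A"
          obtain Z' l' where Zl': "e = (Z', l')" by (cases e)
          note weak' = weak[OF e[unfolded Zl']]
          have "Z' = Z" using one[of Z' Z] weak' weak[OF Zl] by blast
          then show "e \<in> {(Z, k)}" using weak' Zl' by simp
        qed (use Zl weak[OF Zl] in simp)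
        moreover have "Z \<in> W" using weak[OF Zl] sub[of Z k] by (simp add: W_def)
        ultimately show ?thesis by (simp add: R2_def)
      qed (simp add: R2_def)
      have T_eq: "T = join (f, A)" by (auto simp: join_def f_def A_def)
      have "?P T = ?P (\<Union>Y'\<in>S. f Y') * ?P A"
        unfolding T_eq join_def prod.case
        by (rule prod.union_disjoint) (use \<open>finite T\<close> finS in \<open>auto simp: f_def A_def\<close>)
      also have "?P (\<Union>Y'\<in>S. f Y') = (\<Prod>Y'\<in>S. ?P (f Y'))"
        by (rule prod.UNION_disjoint) (use \<open>finite T\<close> finS in \<open>auto simp: f_def\<close>)
      finally show "\<exists>y\<in>PiE S R \<times> R2. join y = T \<and>
          ?P T \<le> (case y of (f, A) \<Rightarrow> (\<Prod>Y'\<in>S. ?P (f Y')) * ?P A)"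
        using f A T_eq by (intro bexI[of _ "(f, A)"]) simp_all
    qed
  qed
  also have "\<dots> = (\<Sum>f\<in>PiE S R. \<Prod>Y'\<in>S. ?P (f Y')) * (\<Sum>A\<in>R2. ?P A)"
    by (simp add: sum_product sum.cartesian_product)
  also have "(\<Sum>f\<in>PiE S R. \<Prod>Y'\<in>S. ?P (f Y')) = (\<Prod>Y'\<in>S. \<Sum>A\<in>R Y'. ?P A)"
    by (rule prod_sum_PiE[symmetric]) (use finS finR in auto)
  also have "(\<Prod>Y'\<in>S. \<Sum>A\<in>R Y'. ?P A) = (\<Prod>Y'\<in>S. 1 + (\<Sum>k'\<in>{1..K}. \<mu> (Y', k')))"
    unfolding R_def by (intro prod.cong refl sum_at_most_one) (auto simp: inj_on_def)
  also have "(\<Sum>A\<in>R2. ?P A) = 1 + (\<Sum>Y''\<in>W. \<mu> (Y'', k))"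
    unfolding R2_def by (rule sum_at_most_one) (use finS in \<open>auto simp: inj_on_def\<close>)
  finally show ?thesis unfolding S_def W_def .
qed

text \<open>
  For \<open>\<mu> = e p\<^sup>Y Q\<^sub>k(Y)\<close> only sets of supported neighbours contribute. There are at most \<open>D\<close> such neighbours, each
  with \<open>\<mu> \<le> e P\<close>, so the sum is at most \<open>\<Prod>(1 + \<mu>) \<le> exp (\<Sum>\<mu>) \<le> exp (e P D) \<le> e\<close>.
\<close>
lemma sum_GNS_symmetric_le:
  fixes P D :: real
  assumes Y: "Y \<in> atomic_sets n F" and k: "k \<in> {1..K}" and supported: "0 < Q k Y"
    and P: "\<And>e. e \<in> labels \<Longrightarrow> weight e \<le> P"
    and D: "real (card {(Y', k'). Y' \<in> atomic_sets n F \<and> k' \<in> {1..K} \<and> Q k' Y' > 0 \<and>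
              approx_pair \<B> (Y', k') (Y, k)}) \<le> D"
    and PD: "exp 1 * P * D \<le> 1"
  shows "(\<Sum>T\<in>GNS n F K \<B> Y k. \<Prod>e\<in>T. exp 1 * weight e) \<le> exp 1"
proof -
  define A where "A = {(Y', k'). Y' \<in> atomic_sets n F \<and> k' \<in> {1..K} \<and> Q k' Y' > 0 \<and>
      approx_pair \<B> (Y', k') (Y, k)}"
  let ?\<mu> = "\<lambda>e. exp 1 * weight e"
  have A: "A \<subseteq> labels" by (auto simp: A_def)
  then have finA: "finite A" using finite_labels finite_subset by blast
  have pos: "0 \<le> ?\<mu> e" if "e \<in> labels" for e using weight_nonneg[OF that] by simp
  have zero: "(\<Prod>e\<in>T. ?\<mu> e) = 0" if T: "T \<in> GNS n F K \<B> Y k" "\<not> T \<subseteq> A" for T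
  proof -
    obtain Z l where Zl: "(Z, l) \<in> T" "(Z, l) \<notin> A" using T(2) by auto
    have "(Z, l) \<in> labels" "approx_pair \<B> (Z, l) (Y, k)"
      using T(1) Zl(1) by (auto simp: GNS_def approx_pair_def)
    then have "Q l Z = 0" using Zl(2) Q_nonneg[of l Z] by (force simp: A_def)
    moreover have "finite T"
      using T(1) finite_subset[OF _ finite_labels] by (auto simp: GNS_def labels_def)
    ultimately show ?thesis using Zl(1) by (intro prod_zero bexI[of _ "(Z, l)"]) simp_all
  qed
  have "(\<Sum>T\<in>GNS n F K \<B> Y k. \<Prod>e\<in>T. ?\<mu> e) = (\<Sum>T\<in>GNS n F K \<B> Y k \<inter> Pow A. \<Prod>e\<in>T. ?\<mu> e)"
    using finite_GNS zero by (intro sum.mono_neutral_right) auto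
  also have "\<dots> \<le> (\<Sum>T\<in>Pow A. \<Prod>e\<in>T. ?\<mu> e)"
    using finA A pos by (intro sum_mono2 prod_nonneg) auto
  also have "\<dots> = (\<Prod>e\<in>A. ?\<mu> e + 1)"
    by (subst prod_add[OF finA]) simp
  also have "\<dots> \<le> (\<Prod>e\<in>A. exp (?\<mu> e))"
  proof (intro prod_mono conjI)
    fix e assume "e \<in> A"
    then show "0 \<le> ?\<mu> e + 1" using pos A by (meson add_nonneg_nonneg subsetD zero_le_one)
    show "?\<mu> e + 1 \<le> exp (?\<mu> e)" using exp_ge_add_one_self[of "?\<mu> e"] by (simp add: add.commute)
  qed
  also have "\<dots> = exp (\<Sum>e\<in>A. ?\<mu> e)" by (simp add: exp_sum finA)
  also have "\<dots> \<le> exp 1"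
  proof -
    have "0 \<le> P" using weight_nonneg[of "(Y, k)"] P[of "(Y, k)"] Y k by simp
    have "(\<Sum>e\<in>A. ?\<mu> e) \<le> (\<Sum>e\<in>A. exp 1 * P)"
      using P A by (intro sum_mono mult_left_mono) auto
    also have "\<dots> = exp 1 * P * real (card A)" by simp
    also have "\<dots> \<le> exp 1 * P * D"
      using D \<open>0 \<le> P\<close> unfolding A_def by (intro mult_left_mono) simp_all
    also have "\<dots> \<le> 1" by (rule PD)
    finally show ?thesis by simp
  qed
  finally show ?thesis .
qed

end

theorem theorem3p6:
  fixes n K :: nat
    and F :: "nat \<Rightarrow> 'v set"
    and p :: "'v element \<Rightarrow> real"
    and \<B> :: "nat \<Rightarrow> 'v element set set"
    and Q :: "nat \<Rightarrow> 'v element set \<Rightarrow> real"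
    and sel :: "'v selection"
  assumes "\<And>i. i \<in> {1..n} \<Longrightarrow> finite (F i)"
    and "probability_vector n F p"
    and "\<And>k. k \<in> {1..K} \<Longrightarrow> \<B> k \<subseteq> atomic_sets n F"
    and "\<And>k. k \<in> {1..K} \<Longrightarrow> fractional_hitting_set n F (\<B> k) (Q k)"
    and "valid_selection n F K \<B> sel"
  shows
    "(\<forall>\<mu> :: 'v element set \<times> nat \<Rightarrow> real.
        (\<forall>Y\<in>atomic_sets n F. \<forall>k\<in>{1..K}. \<mu> (Y, k) \<ge> 0) \<and>
        (\<forall>Y\<in>atomic_sets n F. \<forall>k\<in>{1..K}.
           \<mu> (Y, k) \<ge> (\<Prod>x\<in>Y. p x) * Q k Y *
              (\<Sum>T\<in>GNS n F K \<B> Y k. \<Prod>(Y', k')\<in>T. \<mu> (Y', k'))) \<longrightarrow>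
        terminates_avoiding K \<B> (pra_multi n F p K \<B> Q sel) \<and>
        expected_resamplings (pra_multi n F p K \<B> Q sel)
          \<le> ennreal (\<Sum>(Y, k)\<in>atomic_sets n F \<times> {1..K}. \<mu> (Y, k))) \<and>
     (\<forall>\<mu> :: 'v element set \<times> nat \<Rightarrow> real.
        (\<forall>Y\<in>atomic_sets n F. \<forall>k\<in>{1..K}. \<mu> (Y, k) \<ge> 0) \<and>
        (\<forall>Y\<in>atomic_sets n F. \<forall>k\<in>{1..K}.
           \<mu> (Y, k) \<ge> (\<Prod>x\<in>Y. p x) * Q k Y *
              (\<Prod>Y'\<in>{Y'\<in>atomic_sets n F. sim Y' Y}. 1 + (\<Sum>k'\<in>{1..K}. \<mu> (Y', k'))) *
              (1 + (\<Sum>Y''\<in>{Y''\<in>atomic_sets n F. bowtie (\<B> k) Y'' Y}. \<mu> (Y'', k)))) \<longrightarrow>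
        terminates_avoiding K \<B> (pra_multi n F p K \<B> Q sel) \<and>
        expected_resamplings (pra_multi n F p K \<B> Q sel)
          \<le> ennreal (\<Sum>(Y, k)\<in>atomic_sets n F \<times> {1..K}. \<mu> (Y, k))) \<and>
     (\<forall>P D :: real.
        (\<forall>Y\<in>atomic_sets n F. \<forall>k\<in>{1..K}. (\<Prod>x\<in>Y. p x) * Q k Y \<le> P) \<and>
        (\<forall>Y\<in>atomic_sets n F. \<forall>k\<in>{1..K}. Q k Y > 0 \<longrightarrow>
           real (card {(Y', k'). Y' \<in> atomic_sets n F \<and> k' \<in> {1..K} \<and> Q k' Y' > 0 \<and>
                                 approx_pair \<B> (Y', k') (Y, k)}) \<le> D) \<and>
        exp 1 * P * D \<le> 1 \<longrightarrow>
        terminates_avoiding K \<B> (pra_multi n F p K \<B> Q sel) \<and>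
        expected_resamplings (pra_multi n F p K \<B> Q sel)
          \<le> ennreal (exp 1 * (\<Sum>(Y, k)\<in>atomic_sets n F \<times> {1..K}. (\<Prod>x\<in>Y. p x) * Q k Y)))"
proof -
  interpret partial_resampling n K F p \<B> Q
    using assms(1-4) by unfold_locales
  let ?run = "pra_multi n F p K \<B> Q sel"
  have labels_sum: "(\<Sum>(Y, k)\<in>atomic_sets n F \<times> {1..K}. g (Y, k)) = (\<Sum>e\<in>labels. g e)"
    for g :: "'v element set \<times> nat \<Rightarrow> real"
    by (simp add: labels_def split_def)
  have criterion: "terminates_avoiding K \<B> ?run \<and>
      expected_resamplings ?run \<le> ennreal (\<Sum>(Y, k)\<in>atomic_sets n F \<times> {1..K}. \<mu> (Y, k))"
    if "\<forall>Y\<in>atomic_sets n F. \<forall>k\<in>{1..K}. \<mu> (Y, k) \<ge> 0"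
      "\<forall>Y\<in>atomic_sets n F. \<forall>k\<in>{1..K}.
        \<mu> (Y, k) \<ge> (\<Prod>x\<in>Y. p x) * Q k Y * (\<Sum>T\<in>GNS n F K \<B> Y k. \<Prod>e\<in>T. \<mu> e)"
    for \<mu> :: "'v element set \<times> nat \<Rightarrow> real"
    unfolding labels_sum
  proof (rule good_neighbour_criterion[OF assms(5)])
    show "0 \<le> \<mu> e" if "e \<in> labels" for e
      using that \<open>\<forall>Y\<in>atomic_sets n F. \<forall>k\<in>{1..K}. \<mu> (Y, k) \<ge> 0\<close> by (cases e) simp
  qed (use that(2) in auto)
  have case_a: "terminates_avoiding K \<B> ?run \<and>
      expected_resamplings ?run \<le> ennreal (\<Sum>(Y, k)\<in>atomic_sets n F \<times> {1..K}. \<mu> (Y, k))"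
    if "(\<forall>Y\<in>atomic_sets n F. \<forall>k\<in>{1..K}. \<mu> (Y, k) \<ge> 0) \<and>
        (\<forall>Y\<in>atomic_sets n F. \<forall>k\<in>{1..K}.
           \<mu> (Y, k) \<ge> (\<Prod>x\<in>Y. p x) * Q k Y *
              (\<Sum>T\<in>GNS n F K \<B> Y k. \<Prod>(Y', k')\<in>T. \<mu> (Y', k')))"
    for \<mu> :: "'v element set \<times> nat \<Rightarrow> real"
    using criterion[of \<mu>] that by simp
  have case_b: "terminates_avoiding K \<B> ?run \<and>
      expected_resamplings ?run \<le> ennreal (\<Sum>(Y, k)\<in>atomic_sets n F \<times> {1..K}. \<mu> (Y, k))"
    if \<mu>: "(\<forall>Y\<in>atomic_sets n F. \<forall>k\<in>{1..K}. \<mu> (Y, k) \<ge> 0) \<and>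
        (\<forall>Y\<in>atomic_sets n F. \<forall>k\<in>{1..K}.
           \<mu> (Y, k) \<ge> (\<Prod>x\<in>Y. p x) * Q k Y *
              (\<Prod>Y'\<in>{Y'\<in>atomic_sets n F. sim Y' Y}. 1 + (\<Sum>k'\<in>{1..K}. \<mu> (Y', k'))) *
              (1 + (\<Sum>Y''\<in>{Y''\<in>atomic_sets n F. bowtie (\<B> k) Y'' Y}. \<mu> (Y'', k))))"
    for \<mu> :: "'v element set \<times> nat \<Rightarrow> real"
  proof (rule criterion[OF conjunct1[OF \<mu>]], intro ballI)
    fix Y k assume Y: "Y \<in> atomic_sets n F" and k: "k \<in> {1..K}"
    have pos: "0 \<le> \<mu> e" if "e \<in> labels" for e
      using \<mu> that by (cases e) simp
    have "(\<Prod>x\<in>Y. p x) * Q k Y * (\<Sum>T\<in>GNS n F K \<B> Y k. \<Prod>e\<in>T. \<mu> e) \<le>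
      (\<Prod>x\<in>Y. p x) * Q k Y *
        ((\<Prod>Y'\<in>{Y'\<in>atomic_sets n F. sim Y' Y}. 1 + (\<Sum>k'\<in>{1..K}. \<mu> (Y', k'))) *
         (1 + (\<Sum>Y''\<in>{Y''\<in>atomic_sets n F. bowtie (\<B> k) Y'' Y}. \<mu> (Y'', k))))"
      by (intro mult_left_mono sum_GNS_le mult_nonneg_nonneg prod_p_nonneg Q_nonneg Y k pos)
    also have "\<dots> \<le> \<mu> (Y, k)"
      using conjunct2[OF \<mu>, rule_format, OF Y k] by (simp only: mult.assoc)
    finally show "(\<Prod>x\<in>Y. p x) * Q k Y * (\<Sum>T\<in>GNS n F K \<B> Y k. \<Prod>e\<in>T. \<mu> e) \<le> \<mu> (Y, k)" .
  qed
  have case_c: "terminates_avoiding K \<B> ?run \<and>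
      expected_resamplings ?run
        \<le> ennreal (exp 1 * (\<Sum>(Y, k)\<in>atomic_sets n F \<times> {1..K}. (\<Prod>x\<in>Y. p x) * Q k Y))"
    if PD: "(\<forall>Y\<in>atomic_sets n F. \<forall>k\<in>{1..K}. (\<Prod>x\<in>Y. p x) * Q k Y \<le> P) \<and>
        (\<forall>Y\<in>atomic_sets n F. \<forall>k\<in>{1..K}. Q k Y > 0 \<longrightarrow>
           real (card {(Y', k'). Y' \<in> atomic_sets n F \<and> k' \<in> {1..K} \<and> Q k' Y' > 0 \<and>
                                 approx_pair \<B> (Y', k') (Y, k)}) \<le> D) \<and>
        exp 1 * P * D \<le> 1" for P D :: real
  proof -
    have "exp 1 * (\<Sum>(Y, k)\<in>atomic_sets n F \<times> {1..K}. (\<Prod>x\<in>Y. p x) * Q k Y) =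
        (\<Sum>(Y, k)\<in>atomic_sets n F \<times> {1..K}. exp 1 * weight (Y, k))"
      by (simp add: sum_distrib_left split_def)
    moreover have "terminates_avoiding K \<B> ?run \<and> expected_resamplings ?run \<le>
        ennreal (\<Sum>(Y, k)\<in>atomic_sets n F \<times> {1..K}. exp 1 * weight (Y, k))"
    proof (rule criterion; intro ballI)
      fix Y k assume Y: "Y \<in> atomic_sets n F" and k: "k \<in> {1..K}"
      have w: "0 \<le> weight (Y, k)" using weight_nonneg[of "(Y, k)"] Y k by simp
      then show "0 \<le> exp 1 * weight (Y, k)" by simp
      show "(\<Prod>x\<in>Y. p x) * Q k Y * (\<Sum>T\<in>GNS n F K \<B> Y k. \<Prod>e\<in>T. exp 1 * weight e)
          \<le> exp 1 * weight (Y, k)"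
      proof (cases "Q k Y > 0")
        case True
        have P: "weight e \<le> P" if "e \<in> labels" for e
          using PD that by (cases e) simp
        have D: "real (card {(Y', k'). Y' \<in> atomic_sets n F \<and> k' \<in> {1..K} \<and> Q k' Y' > 0 \<and>
                                 approx_pair \<B> (Y', k') (Y, k)}) \<le> D"
          using PD True Y k by blast
        have "(\<Sum>T\<in>GNS n F K \<B> Y k. \<Prod>e\<in>T. exp 1 * weight e) \<le> exp 1"
          using sum_GNS_symmetric_le[OF Y k True P D] PD by blast
        from mult_left_mono[OF this w] show ?thesis by (simp add: mult.commute)
      next
        case False
        then have "Q k Y = 0" using Q_nonneg[OF k Y] by simp
        then show ?thesis by simp
      qed
    qed
    ultimately show ?thesis by simp
  qed
  show ?thesis
    by (rule conjI, intro allI impI, erule case_a,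
        rule conjI, intro allI impI, erule case_b, intro allI impI, erule case_c)
qed

end
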